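(* Assume $f\in C^2(\mathbb{R})$ satisfies (F1), (F2), (F3) of the context. For each $\varepsilon\in(0,1]$, let $\mathcal{A}_\varepsilon$ be the global attractor and $\mathcal{M}_\varepsilon$ an exponential attractor of the dynamical system $(S_\varepsilon,\mathcal{H}_\varepsilon)$ generated by problem $(P_\varepsilon)$. Then $$\dim_F(\mathcal{A}_\varepsilon,\mathcal{H}_\varepsilon)\le\dim_F(\mathcal{M}_\varepsilon,\mathcal{H}_\varepsilon).$$ As a consequence, $\mathcal{A}_\varepsilon$ has finite fractal dimension (depending on $\varepsilon>0$).
   Context: $\Omega\subset\mathbb{R}^3$ is a bounded domain with boundary $\Gamma$ of class $C^2$ and outward unit normal $\mathbf{n}$. $\|\cdot\|$ is the norm of $L^2(\Omega)$; $\|u\|_1^2:=\|\nabla u\|^2+\|u\|_{L^2(\Gamma)}^2$ (an equivalent norm on $H^1(\Omega)$); $\|\cdot\|_2$ is the $H^2(\Omega)$ norm. $\lambda>0$ is the best constant in $\lambda\int_\Omega u^2dx\le\int_\Omega|\nabla u|^2dx+\int_\Gamma u^2dS$, $u\in H^1(\Omega)$. Assumptions on $f\in C^2(\mathbb{R})$: (F1) there is $\ell\ge0$ with $|f''(s)|\le\ell(1+|s|)$ for all $s$; (F2) $\liminf_{|s|\to\infty}f(s)/s>-\lambda$; (F3) there is $\vartheta>0$ with $f'(s)\ge-\vartheta$ for all $s$. Problem $(P_\varepsilon)$, $\varepsilon\in(0,1]$: $\varepsilon u_{tt}+u_t-\Delta u+f(u)=0$ in $(0,\infty)\times\Omega$;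 $\partial_{\mathbf n}u+u+u_t=0$ on $(0,\infty)\times\Gamma$; $u(0)=u_0$, $u_t(0)=u_1$ in $\Omega$. $\mathcal{H}_\varepsilon:=H^1(\Omega)\times L^2(\Omega)$ with $\|(u,v)\|_{\mathcal{H}_\varepsilon}^2:=\|u\|_1^2+\varepsilon\|v\|^2$. $\mathcal{D}_\varepsilon:=\{(u,v)\in H^2(\Omega)\times H^1(\Omega):\partial_{\mathbf n}u+u=-v\text{ on }\Gamma\}$ with $\|(u,v)\|_{\mathcal{D}_\varepsilon}^2:=\|u\|_2^2+\|v\|_1^2$. The operator $A_\varepsilon(u,v):=(v,\tfrac1\varepsilon(\Delta u-v))$ with domain $\mathcal{D}_\varepsilon$ generates a strongly continuous contraction semigroup $e^{A_\varepsilon t}$ on $\mathcal{H}_\varepsilon$; put $\mathcal{F}(u,v):=(0,-\tfrac1\varepsilon f(u))$. A weak solution on $[0,T]$ with initial datum $\varphi_0=(u_0,u_1)\in\mathcal{H}_\varepsilon$ is $\varphi=(u,u_t):[0,T]\to\mathcal{H}_\varepsilon$ with $\mathcal{F}(\varphi(\cdot))\in L^1(0,T;\mathcal{H}_\varepsilon)$ and $\varphi(t)=e^{A_\varepsilon t}\varphi_0+\int_0^te^{A_\varepsilon(t-s)}\mathcal{F}(\varphi(s))ds$ for all $t\in[0,T]$. For each $\varphi_0\in\mathcal{H}_\varepsilon$ there is a unique global weak solution $\varphi\in C([0,\infty);\mathcal{H}_\varepsilon)$, and $S_\varepsilon(t)\varphi_0:=\varphi(t)$. A global attractor is a compact, invariant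 ($S_\varepsilon(t)\mathcal{A}_\varepsilon=\mathcal{A}_\varepsilon$) set attracting every bounded set. An exponential attractor is a compact, positively invariant ($S_\varepsilon(t)\mathcal{M}_\varepsilon\subseteq\mathcal{M}_\varepsilon$) set of finite fractal dimension attracting every bounded subset of $\mathcal{H}_\varepsilon$ exponentially fast in the Hausdorff semidistance of $\mathcal{H}_\varepsilon$. Under (F1)–(F3), both exist for every $\varepsilon\in(0,1]$. The fractal dimension is $\dim_F(\mathcal{Z},\mathcal{H}_\varepsilon):=\limsup_{r\to0}\frac{\ln\mu_{\mathcal{H}_\varepsilon}(\mathcal{Z},r)}{-\ln r}$, where $\mu_{\mathcal{H}_\varepsilon}(\mathcal{Z},r)$ is the minimum number of $r$-balls of $\mathcal{H}_\varepsilon$ needed to cover $\mathcal{Z}$. *)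

theory Defs
  imports "HOL-Analysis.Analysis"
begin

section \<open>Functions modulo equality almost everywhere\<close>

type_synonym R3 = "real^3"

definition ae_rel :: "(R3 \<Rightarrow> real) \<Rightarrow> (R3 \<Rightarrow> real) \<Rightarrow> bool" where
  "ae_rel f g \<longleftrightarrow> f \<in> borel_measurable lebesgue \<and> g \<in> borel_measurable lebesgue \<and>
     (AE x in lebesgue. f x = g x)"

lemma ae_rel_part_equivp: "part_equivp ae_rel"
proof (rule part_equivpI)
  show "\<exists>f. ae_rel f f"
    by (rule exI[of _ "\<lambda>_. 0"]) (simp add: ae_rel_def)
  show "symp ae_rel"
    by (auto simp: symp_def ae_rel_def)
  show "transp ae_rel"
    unfolding transp_def ae_rel_def by (auto elim!: eventually_elim2)
qed

quotient_type ae_fun = "R3 \<Rightarrow> real" / partial: ae_rel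
  by (rule ae_rel_part_equivp)

instantiation ae_fun :: real_vector
begin

lift_definition zero_ae_fun :: ae_fun is "\<lambda>_. 0"
  by (simp add: ae_rel_def)

lift_definition plus_ae_fun :: "ae_fun \<Rightarrow> ae_fun \<Rightarrow> ae_fun" is "\<lambda>f g x. f x + g x"
  unfolding ae_rel_def by (auto elim!: eventually_elim2)

lift_definition minus_ae_fun :: "ae_fun \<Rightarrow> ae_fun \<Rightarrow> ae_fun" is "\<lambda>f g x. f x - g x"
  unfolding ae_rel_def by (auto elim!: eventually_elim2)

lift_definition uminus_ae_fun :: "ae_fun \<Rightarrow> ae_fun" is "\<lambda>f x. - f x"
  unfolding ae_rel_def by (auto elim!: eventually_mono)

lift_definition scaleR_ae_fun :: "real \<Rightarrow> ae_fun \<Rightarrow> ae_fun" is "\<lambda>c f x. c * f x"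
  unfolding ae_rel_def by (auto elim!: eventually_mono)

instance
  by standard (transfer; auto simp: ae_rel_def algebra_simps)+

end

section \<open>Domains with boundary of class \<open>C\<^sup>2\<close>\<close>

primrec Ck_on :: "nat \<Rightarrow> 'a::euclidean_space set \<Rightarrow> ('a \<Rightarrow> real) \<Rightarrow> bool" where
  "Ck_on 0 U f \<longleftrightarrow> continuous_on U f"
| "Ck_on (Suc k) U f \<longleftrightarrow> (\<forall>x\<in>U. f differentiable (at x)) \<and>
     (\<forall>b\<in>Basis. Ck_on k U (\<lambda>x. frechet_derivative f (at x) b))"

definition local_defining :: "R3 set \<Rightarrow> R3 \<Rightarrow> (R3 \<Rightarrow> real) \<Rightarrow> bool" where
  "local_defining \<Omega> x \<psi> \<longleftrightarrow> (\<exists>U. open U \<and> x \<in> U \<and> Ck_on 2 U \<psi> \<and>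
     (\<forall>y\<in>U. \<not> GDERIV \<psi> y :> 0) \<and>
     \<Omega> \<inter> U = {y\<in>U. \<psi> y < 0} \<and> frontier \<Omega> \<inter> U = {y\<in>U. \<psi> y = 0})"

definition C2_bounded_domain :: "R3 set \<Rightarrow> bool" where
  "C2_bounded_domain \<Omega> \<longleftrightarrow> open \<Omega> \<and> connected \<Omega> \<and> bounded \<Omega> \<and> \<Omega> \<noteq> {} \<and>
     (\<forall>x\<in>frontier \<Omega>. \<exists>\<psi>. local_defining \<Omega> x \<psi>)"

definition outward_normal :: "R3 set \<Rightarrow> R3 \<Rightarrow> R3" where
  "outward_normal \<Omega> x = (THE \<nu>. \<exists>\<psi> g. local_defining \<Omega> x \<psi> \<and> (GDERIV \<psi> x :> g) \<and>
     \<nu> = g /\<^sub>R norm g)"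

text \<open>
  The surface measure is the two-dimensional Hausdorff measure, normalised by
  \<open>\<pi>/4 \<cdot> (diameter)\<^sup>2\<close> so that it is surface area. The outer measure is countably additive on
  Borel sets, hence \<^const>\<open>measure_of\<close> returns its restriction to them.
\<close>

definition hausdorff_pre :: "real \<Rightarrow> R3 set \<Rightarrow> ennreal" where
  "hausdorff_pre \<delta> E =
     (INF C \<in> {C :: nat \<Rightarrow> R3 set. E \<subseteq> (\<Union>n. C n) \<and> (\<forall>n. bounded (C n) \<and> diameter (C n) \<le> \<delta>)}.
        (\<Sum>n. ennreal (pi / 4 * (diameter (C n))\<^sup>2)))"

definition hausdorff_measure :: "R3 measure" where
  "hausdorff_measure = measure_of UNIV (sets borel) (\<lambda>E. SUP \<delta>\<in>{0<..}. hausdorff_pre \<delta> E)"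

definition surface_measure :: "R3 set \<Rightarrow> R3 measure" where
  "surface_measure \<Omega> = restrict_space hausdorff_measure (frontier \<Omega>)"

section \<open>Lebesgue and Sobolev spaces\<close>

text \<open>
  A function on \<open>\<Omega>\<close> is identified with its extension by zero. The extension is a device
  to have one type of equivalence classes for all \<open>\<Omega>\<close>; derivatives are only tested inside \<open>\<Omega>\<close>.
\<close>

definition L2 :: "R3 set \<Rightarrow> ae_fun set" where
  "L2 \<Omega> = {u. (AE x in lebesgue. x \<notin> \<Omega> \<longrightarrow> rep_ae_fun u x = 0) \<and>
     integrable lebesgue (\<lambda>x. (rep_ae_fun u x)\<^sup>2)}"

definition L2_norm :: "R3 set \<Rightarrow> ae_fun \<Rightarrow> real" where
  "L2_norm \<Omega> u = sqrt (LINT x:\<Omega>|lebesgue. (rep_ae_fun u x)\<^sup>2)"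

definition test_functions :: "R3 set \<Rightarrow> (R3 \<Rightarrow> real) set" where
  "test_functions \<Omega> = {\<phi>. (\<forall>k. Ck_on k UNIV \<phi>) \<and>
     compact (closure {x. \<phi> x \<noteq> 0}) \<and> closure {x. \<phi> x \<noteq> 0} \<subseteq> \<Omega>}"

definition has_weak_deriv :: "R3 set \<Rightarrow> R3 \<Rightarrow> ae_fun \<Rightarrow> ae_fun \<Rightarrow> bool" where
  "has_weak_deriv \<Omega> b u w \<longleftrightarrow> (\<forall>\<phi>\<in>test_functions \<Omega>.
     (LINT x:\<Omega>|lebesgue. rep_ae_fun u x * frechet_derivative \<phi> (at x) b)
       = - (LINT x:\<Omega>|lebesgue. rep_ae_fun w x * \<phi> x))"

definition weak_deriv :: "R3 set \<Rightarrow> R3 \<Rightarrow> ae_fun \<Rightarrow> ae_fun" where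
  "weak_deriv \<Omega> b u = (THE w. w \<in> L2 \<Omega> \<and> has_weak_deriv \<Omega> b u w)"

definition H1 :: "R3 set \<Rightarrow> ae_fun set" where
  "H1 \<Omega> = {u \<in> L2 \<Omega>. \<forall>b\<in>Basis. \<exists>w\<in>L2 \<Omega>. has_weak_deriv \<Omega> b u w}"

definition H2 :: "R3 set \<Rightarrow> ae_fun set" where
  "H2 \<Omega> = {u \<in> H1 \<Omega>. \<forall>b\<in>Basis. weak_deriv \<Omega> b u \<in> H1 \<Omega>}"

definition laplacian :: "R3 set \<Rightarrow> ae_fun \<Rightarrow> ae_fun" where
  "laplacian \<Omega> u = (\<Sum>b\<in>Basis. weak_deriv \<Omega> b (weak_deriv \<Omega> b u))"

definition grad_norm_sq :: "R3 set \<Rightarrow> ae_fun \<Rightarrow> real" where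
  "grad_norm_sq \<Omega> u = (\<Sum>b\<in>Basis. (L2_norm \<Omega> (weak_deriv \<Omega> b u))\<^sup>2)"

text \<open>
  The trace operator: the bounded linear operator from \<open>H\<^sup>1(\<Omega>)\<close> to \<open>L\<^sup>2(\<Gamma>)\<close> that restricts
  functions continuous up to the boundary. Its values are representatives, so its properties hold
  almost everywhere on \<open>\<Gamma>\<close>.
\<close>

definition trace_operator :: "R3 set \<Rightarrow> (ae_fun \<Rightarrow> R3 \<Rightarrow> real) \<Rightarrow> bool" where
  "trace_operator \<Omega> T \<longleftrightarrow>
     (\<forall>u\<in>H1 \<Omega>. T u \<in> borel_measurable (surface_measure \<Omega>) \<and>
        integrable (surface_measure \<Omega>) (\<lambda>x. (T u x)\<^sup>2)) \<and>
     (\<forall>u\<in>H1 \<Omega>. \<forall>v\<in>H1 \<Omega>. AE x in surface_measure \<Omega>. T (u + v) x = T u x + T v x) \<and>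
     (\<forall>c. \<forall>u\<in>H1 \<Omega>. AE x in surface_measure \<Omega>. T (c *\<^sub>R u) x = c * T u x) \<and>
     (\<exists>C. \<forall>u\<in>H1 \<Omega>. (LINT x|surface_measure \<Omega>. (T u x)\<^sup>2)
        \<le> C * ((L2_norm \<Omega> u)\<^sup>2 + grad_norm_sq \<Omega> u)) \<and>
     (\<forall>u\<in>H1 \<Omega>. \<forall>w. continuous_on (closure \<Omega>) w \<and>
        (AE x in lebesgue. x \<in> \<Omega> \<longrightarrow> rep_ae_fun u x = w x) \<longrightarrow>
        (AE x in surface_measure \<Omega>. T u x = w x))"

text \<open>
  By the trace theorem such an operator exists on every bounded \<open>C\<^sup>1\<close> domain, and it is unique up
  to null sets; the zero operator is only the value outside the scope of that theorem.
\<close>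

definition bdry_trace :: "R3 set \<Rightarrow> ae_fun \<Rightarrow> R3 \<Rightarrow> real" where
  "bdry_trace \<Omega> = (if \<exists>T. trace_operator \<Omega> T then SOME T. trace_operator \<Omega> T else (\<lambda>_ _. 0))"

definition normal_deriv :: "R3 set \<Rightarrow> ae_fun \<Rightarrow> R3 \<Rightarrow> real" where
  "normal_deriv \<Omega> u x =
     (\<Sum>b\<in>Basis. (outward_normal \<Omega> x \<bullet> b) * bdry_trace \<Omega> (weak_deriv \<Omega> b u) x)"

definition H1_norm :: "R3 set \<Rightarrow> ae_fun \<Rightarrow> real" where
  "H1_norm \<Omega> u =
     sqrt (grad_norm_sq \<Omega> u + (LINT x|surface_measure \<Omega>. (bdry_trace \<Omega> u x)\<^sup>2))"

definition best_const :: "R3 set \<Rightarrow> real" where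
  "best_const \<Omega> = Sup {c. \<forall>u\<in>H1 \<Omega>. c * (L2_norm \<Omega> u)\<^sup>2 \<le> (H1_norm \<Omega> u)\<^sup>2}"

section \<open>Analysis in a subspace carrying its own norm\<close>

text \<open>
  The spaces \<open>\<H>\<^sub>\<epsilon>\<close> depend on \<open>\<epsilon>\<close> and \<open>\<Omega>\<close>, so they are pairs of a linear subspace \<open>V\<close> and
  a norm \<open>N\<close> on it rather than instances of a class.
\<close>

definition norm_topology :: "'v::real_vector set \<Rightarrow> ('v \<Rightarrow> real) \<Rightarrow> 'v topology" where
  "norm_topology V N =
     topology (\<lambda>U. U \<subseteq> V \<and> (\<forall>x\<in>U. \<exists>r>0. \<forall>y\<in>V. N (y - x) < r \<longrightarrow> y \<in> U))"

definition bounded_in :: "'v::real_vector set \<Rightarrow> ('v \<Rightarrow> real) \<Rightarrow> 'v set \<Rightarrow> bool" where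
  "bounded_in V N B \<longleftrightarrow> B \<subseteq> V \<and> (\<exists>R. \<forall>x\<in>B. N x \<le> R)"

definition simple_on :: "'v::real_vector set \<Rightarrow> real \<Rightarrow> real \<Rightarrow> (real \<Rightarrow> 'v) \<Rightarrow> bool" where
  "simple_on V a b s \<longleftrightarrow> finite (s ` {a..b}) \<and> s ` {a..b} \<subseteq> V \<and>
     (\<forall>x. {t\<in>{a..b}. s t = x} \<in> sets lebesgue)"

definition simple_integral_on :: "real \<Rightarrow> real \<Rightarrow> (real \<Rightarrow> 'v::real_vector) \<Rightarrow> 'v" where
  "simple_integral_on a b s =
     (\<Sum>x\<in>s ` {a..b}. measure lebesgue {t\<in>{a..b}. s t = x} *\<^sub>R x)"

text \<open>
  The Bochner integral, as in the library's \<^const>\<open>has_bochner_integral\<close>. Convergence almost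
  everywhere of the simple functions is strong measurability of \<open>g\<close>.
\<close>

definition has_bochner_integral_on ::
  "'v::real_vector set \<Rightarrow> ('v \<Rightarrow> real) \<Rightarrow> real \<Rightarrow> real \<Rightarrow> (real \<Rightarrow> 'v) \<Rightarrow> 'v \<Rightarrow> bool" where
  "has_bochner_integral_on V N a b g I \<longleftrightarrow> I \<in> V \<and>
     (AE t in lebesgue. t \<in> {a..b} \<longrightarrow> g t \<in> V) \<and>
     (\<exists>s. (\<forall>n. simple_on V a b (s n)) \<and>
        (AE t in lebesgue. t \<in> {a..b} \<longrightarrow> (\<lambda>n. N (s n t - g t)) \<longlonglongrightarrow> 0) \<and>
        (\<lambda>n. \<integral>\<^sup>+t\<in>{a..b}. ennreal (N (s n t - g t)) \<partial>lebesgue) \<longlonglongrightarrow> 0 \<and>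
        (\<lambda>n. N (simple_integral_on a b (s n) - I)) \<longlonglongrightarrow> 0)"

definition C0_semigroup ::
  "'v::real_vector set \<Rightarrow> ('v \<Rightarrow> real) \<Rightarrow> (real \<Rightarrow> 'v \<Rightarrow> 'v) \<Rightarrow> bool" where
  "C0_semigroup V N T \<longleftrightarrow>
     (\<forall>t\<ge>0. (\<forall>x\<in>V. T t x \<in> V) \<and>
        (\<forall>x\<in>V. \<forall>y\<in>V. T t (x + y) = T t x + T t y) \<and>
        (\<forall>c. \<forall>x\<in>V. T t (c *\<^sub>R x) = c *\<^sub>R T t x) \<and>
        (\<exists>C. \<forall>x\<in>V. N (T t x) \<le> C * N x)) \<and>
     (\<forall>x\<in>V. T 0 x = x) \<and>
     (\<forall>s\<ge>0. \<forall>t\<ge>0. \<forall>x\<in>V. T (s + t) x = T s (T t x)) \<and>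
     (\<forall>x\<in>V. ((\<lambda>h. N (T h x - x)) \<longlongrightarrow> 0) (at_right 0))"

definition generates ::
  "'v::real_vector set \<Rightarrow> ('v \<Rightarrow> real) \<Rightarrow> 'v set \<Rightarrow> ('v \<Rightarrow> 'v) \<Rightarrow> (real \<Rightarrow> 'v \<Rightarrow> 'v) \<Rightarrow> bool" where
  "generates V N D A T \<longleftrightarrow> C0_semigroup V N T \<and>
     (\<forall>x\<in>V. \<forall>y\<in>V. (x \<in> D \<and> A x = y) \<longleftrightarrow>
        ((\<lambda>h. N ((T h x - x) /\<^sub>R h - y)) \<longlongrightarrow> 0) (at_right 0))"

definition exp_semigroup ::
  "'v::real_vector set \<Rightarrow> ('v \<Rightarrow> real) \<Rightarrow> 'v set \<Rightarrow> ('v \<Rightarrow> 'v) \<Rightarrow> real \<Rightarrow> 'v \<Rightarrow> 'v" where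
  "exp_semigroup V N D A t x = (THE y. \<exists>T. generates V N D A T \<and> y = T t x)"

section \<open>The problem \<open>P\<^sub>\<epsilon>\<close> and its solution operator\<close>

definition H_space :: "R3 set \<Rightarrow> (ae_fun \<times> ae_fun) set" where
  "H_space \<Omega> = H1 \<Omega> \<times> L2 \<Omega>"

definition H_norm :: "R3 set \<Rightarrow> real \<Rightarrow> ae_fun \<times> ae_fun \<Rightarrow> real" where
  "H_norm \<Omega> \<epsilon> = (\<lambda>(u, v). sqrt ((H1_norm \<Omega> u)\<^sup>2 + \<epsilon> * (L2_norm \<Omega> v)\<^sup>2))"

definition D_space :: "R3 set \<Rightarrow> (ae_fun \<times> ae_fun) set" where
  "D_space \<Omega> = {(u, v). u \<in> H2 \<Omega> \<and> v \<in> H1 \<Omega> \<and>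
     (AE x in surface_measure \<Omega>. normal_deriv \<Omega> u x + bdry_trace \<Omega> u x = - bdry_trace \<Omega> v x)}"

definition A_op :: "R3 set \<Rightarrow> real \<Rightarrow> ae_fun \<times> ae_fun \<Rightarrow> ae_fun \<times> ae_fun" where
  "A_op \<Omega> \<epsilon> = (\<lambda>(u, v). (v, (1 / \<epsilon>) *\<^sub>R (laplacian \<Omega> u - v)))"

definition exp_A :: "R3 set \<Rightarrow> real \<Rightarrow> real \<Rightarrow> ae_fun \<times> ae_fun \<Rightarrow> ae_fun \<times> ae_fun" where
  "exp_A \<Omega> \<epsilon> = exp_semigroup (H_space \<Omega>) (H_norm \<Omega> \<epsilon>) (D_space \<Omega>) (A_op \<Omega> \<epsilon>)"

text \<open>The indicator keeps \<open>f \<circ> u\<close> zero outside \<open>\<Omega>\<close> when \<open>f 0 \<noteq> 0\<close>.\<close>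

definition nemytskii :: "R3 set \<Rightarrow> (real \<Rightarrow> real) \<Rightarrow> ae_fun \<Rightarrow> ae_fun" where
  "nemytskii \<Omega> f u = abs_ae_fun (\<lambda>x. indicator \<Omega> x * f (rep_ae_fun u x))"

definition F_op ::
  "R3 set \<Rightarrow> real \<Rightarrow> (real \<Rightarrow> real) \<Rightarrow> ae_fun \<times> ae_fun \<Rightarrow> ae_fun \<times> ae_fun" where
  "F_op \<Omega> \<epsilon> f = (\<lambda>(u, v). (0, - (1 / \<epsilon>) *\<^sub>R nemytskii \<Omega> f u))"

text \<open>The third conjunct says that \<open>\<phi> = (u, u\<^sub>t)\<close>, with \<open>u\<^sub>t\<close> the derivative in \<open>L\<^sup>2(\<Omega>)\<close>.\<close>

definition weak_solution_on ::
  "R3 set \<Rightarrow> real \<Rightarrow> (real \<Rightarrow> real) \<Rightarrow> real \<Rightarrow> ae_fun \<times> ae_fun \<Rightarrow> (real \<Rightarrow> ae_fun \<times> ae_fun) \<Rightarrow> bool" where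
  "weak_solution_on \<Omega> \<epsilon> f T \<phi>0 \<phi> \<longleftrightarrow>
     \<phi>0 \<in> H_space \<Omega> \<and>
     (\<forall>t\<in>{0..T}. \<phi> t \<in> H_space \<Omega>) \<and>
     (\<forall>t\<in>{0..T}. ((\<lambda>s. L2_norm \<Omega> ((fst (\<phi> s) - fst (\<phi> t)) /\<^sub>R (s - t) - snd (\<phi> t))) \<longlongrightarrow> 0)
        (at t within {0..T})) \<and>
     (\<exists>I. has_bochner_integral_on (H_space \<Omega>) (H_norm \<Omega> \<epsilon>) 0 T (\<lambda>s. F_op \<Omega> \<epsilon> f (\<phi> s)) I) \<and>
     (\<forall>t\<in>{0..T}. has_bochner_integral_on (H_space \<Omega>) (H_norm \<Omega> \<epsilon>) 0 t
        (\<lambda>s. exp_A \<Omega> \<epsilon> (t - s) (F_op \<Omega> \<epsilon> f (\<phi> s))) (\<phi> t - exp_A \<Omega> \<epsilon> t \<phi>0))"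

definition global_weak_solution ::
  "R3 set \<Rightarrow> real \<Rightarrow> (real \<Rightarrow> real) \<Rightarrow> ae_fun \<times> ae_fun \<Rightarrow> (real \<Rightarrow> ae_fun \<times> ae_fun) \<Rightarrow> bool" where
  "global_weak_solution \<Omega> \<epsilon> f \<phi>0 \<phi> \<longleftrightarrow>
     (\<forall>T>0. weak_solution_on \<Omega> \<epsilon> f T \<phi>0 \<phi>) \<and>
     (\<forall>t\<ge>0. ((\<lambda>s. H_norm \<Omega> \<epsilon> (\<phi> s - \<phi> t)) \<longlongrightarrow> 0) (at t within {0..}))"

definition S_op ::
  "R3 set \<Rightarrow> real \<Rightarrow> (real \<Rightarrow> real) \<Rightarrow> real \<Rightarrow> ae_fun \<times> ae_fun \<Rightarrow> ae_fun \<times> ae_fun" where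
  "S_op \<Omega> \<epsilon> f t \<phi>0 = (THE y. \<exists>\<phi>. global_weak_solution \<Omega> \<epsilon> f \<phi>0 \<phi> \<and> y = \<phi> t)"

section \<open>Attractors and fractal dimension\<close>

definition semidist :: "('v::real_vector \<Rightarrow> real) \<Rightarrow> 'v set \<Rightarrow> 'v set \<Rightarrow> ennreal" where
  "semidist N X Y = (SUP x\<in>X. INF y\<in>Y. ennreal (N (x - y)))"

definition covering_number ::
  "'v::real_vector set \<Rightarrow> ('v \<Rightarrow> real) \<Rightarrow> 'v set \<Rightarrow> real \<Rightarrow> enat" where
  "covering_number V N Z r =
     (INF C \<in> {C. finite C \<and> C \<subseteq> V \<and> Z \<subseteq> (\<Union>c\<in>C. {y\<in>V. N (y - c) < r})}. enat (card C))"

definition fractal_dim :: "'v::real_vector set \<Rightarrow> ('v \<Rightarrow> real) \<Rightarrow> 'v set \<Rightarrow> ereal" where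
  "fractal_dim V N Z = Limsup (at_right 0) (\<lambda>r.
     case covering_number V N Z r of
       enat n \<Rightarrow> ereal (ln (real n) / (- ln r))
     | \<infinity> \<Rightarrow> \<infinity>)"

definition global_attractor ::
  "'v::real_vector set \<Rightarrow> ('v \<Rightarrow> real) \<Rightarrow> (real \<Rightarrow> 'v \<Rightarrow> 'v) \<Rightarrow> 'v set \<Rightarrow> bool" where
  "global_attractor V N S A \<longleftrightarrow>
     compactin (norm_topology V N) A \<and>
     (\<forall>t\<ge>0. S t ` A = A) \<and>
     (\<forall>B. bounded_in V N B \<longrightarrow> ((\<lambda>t. semidist N (S t ` B) A) \<longlongrightarrow> 0) at_top)"

definition exponential_attractor ::
  "'v::real_vector set \<Rightarrow> ('v \<Rightarrow> real) \<Rightarrow> (real \<Rightarrow> 'v \<Rightarrow> 'v) \<Rightarrow> 'v set \<Rightarrow> bool" where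
  "exponential_attractor V N S M \<longleftrightarrow>
     compactin (norm_topology V N) M \<and>
     (\<forall>t\<ge>0. S t ` M \<subseteq> M) \<and>
     fractal_dim V N M < \<infinity> \<and>
     (\<exists>\<omega>>0. \<forall>B. bounded_in V N B \<longrightarrow>
        (\<exists>C\<ge>0. \<forall>t\<ge>0. semidist N (S t ` B) M \<le> ennreal (C * exp (- \<omega> * t))))"

section \<open>Assumptions on the nonlinearity\<close>

definition F1 :: "(real \<Rightarrow> real) \<Rightarrow> bool" where
  "F1 f \<longleftrightarrow> (\<exists>l\<ge>0. \<forall>s. \<bar>deriv (deriv f) s\<bar> \<le> l * (1 + \<bar>s\<bar>))"

definition F2 :: "R3 set \<Rightarrow> (real \<Rightarrow> real) \<Rightarrow> bool" where
  "F2 \<Omega> f \<longleftrightarrow> Liminf at_infinity (\<lambda>s. ereal (f s / s)) > ereal (- best_const \<Omega>)"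

definition F3 :: "(real \<Rightarrow> real) \<Rightarrow> bool" where
  "F3 f \<longleftrightarrow> (\<exists>\<theta>>0. \<forall>s. deriv f s \<ge> - \<theta>)"

end

theory Submission
  imports Defs "HOL-Computational_Algebra.Polynomial"
begin

text \<open>
  The global attractor \<open>\<A>\<close> is compact, hence bounded, and invariant, so the attraction property of
  \<open>\<M>\<close> applied to \<open>\<A>\<close> itself gives \<open>semidist \<A> \<M> \<le> C e\<^bsup>-\<omega>t\<^esup>\<close> for all \<open>t\<close>. By compactness of \<open>\<M>\<close>
  every point of \<open>\<A>\<close> has distance \<open>0\<close> from a point of \<open>\<M>\<close>, so each cover of \<open>\<M>\<close> by open balls
  covers \<open>\<A>\<close>. Of the phase space this uses only that its norm is a seminorm. Since \<^const>\<open>weak_deriv\<close> is a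
  definite description, its linearity depends on the uniqueness of weak derivatives, that is, on
  the fundamental lemma of the calculus of variations.
\<close>

section \<open>Attractors in a seminormed space\<close>

text \<open>The norm \<open>H_norm\<close> is assembled from \<open>rep_ae_fun\<close>,
  \<open>weak_deriv\<close> and \<open>bdry_trace\<close>, that is, from arbitrary representatives,
  a definite description and a choice, so even its triangle inequality is not a formality. Linearity
  has to be recovered for each of the three: almost everywhere for representatives and traces,
  exactly for weak derivatives. Distance 0 takes the place of the more familiar inclusion of
  \<open>\<A>\<close> in \<open>\<M>\<close>, because that inclusion rests on definiteness of the
  norm, namely that zero gradient and zero trace force a function to vanish. Covering numbers cannot
  see the difference. Boxes are the convenient sets for the fundamental lemma: they generate the
  Borel sets, are closed under intersection, and carry explicit smooth functions built coordinate by
  coordinate.\<close>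

locale seminormed_subspace =
  fixes V :: "'v::real_vector set" and N :: "'v \<Rightarrow> real"
  assumes subspace: "subspace V"
    and triangle: "x \<in> V \<Longrightarrow> y \<in> V \<Longrightarrow> N (x + y) \<le> N x + N y"
    and homogeneous: "x \<in> V \<Longrightarrow> N (c *\<^sub>R x) = \<bar>c\<bar> * N x"
begin

lemma diff_mem: "x \<in> V \<Longrightarrow> y \<in> V \<Longrightarrow> x - y \<in> V"
  using subspace by (rule subspace_diff)

lemma zero_mem: "0 \<in> V"
  using subspace by (rule subspace_0)

lemma norm_zero: "N 0 = 0"
  using homogeneous[OF zero_mem, of 0] by simp

lemma diff_commute: "x \<in> V \<Longrightarrow> y \<in> V \<Longrightarrow> N (x - y) = N (y - x)"
  using homogeneous[of "y - x" "-1"] diff_mem by simp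

lemma diff_triangle: "x \<in> V \<Longrightarrow> y \<in> V \<Longrightarrow> z \<in> V \<Longrightarrow> N (x - z) \<le> N (x - y) + N (y - z)"
  using triangle[of "x - y" "y - z"] diff_mem by simp

text \<open>The way from \<open>x\<close> to 0 and back dominates \<open>N 0 = 0\<close>, hence
  \<open>0 \<le> 2 * N x\<close>.\<close>

lemma nonneg: "x \<in> V \<Longrightarrow> 0 \<le> N x"
  using diff_triangle[of x 0 x] diff_commute[of x 0] norm_zero zero_mem by simp

text \<open>\<open>topology\<close> is the abstraction map of a type, so the predicate in
  \<open>norm_topology\<close> can be recovered from it only after \<open>istopology\<close> has
  been verified.\<close>

lemma openin_norm_topology:
  "openin (norm_topology V N) U \<longleftrightarrow> U \<subseteq> V \<and> (\<forall>x\<in>U. \<exists>r>0. \<forall>y\<in>V. N (y - x) < r \<longrightarrow> y \<in> U)"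
proof -
  have "istopology (\<lambda>U. U \<subseteq> V \<and> (\<forall>x\<in>U. \<exists>r>0. \<forall>y\<in>V. N (y - x) < r \<longrightarrow> y \<in> U))"
    unfolding istopology_def
  proof (intro conjI allI impI)
    fix S T assume S: "S \<subseteq> V \<and> (\<forall>x\<in>S. \<exists>r>0. \<forall>y\<in>V. N (y - x) < r \<longrightarrow> y \<in> S)"
      and T: "T \<subseteq> V \<and> (\<forall>x\<in>T. \<exists>r>0. \<forall>y\<in>V. N (y - x) < r \<longrightarrow> y \<in> T)"
    show "S \<inter> T \<subseteq> V" using S by blast
    show "\<forall>x\<in>S \<inter> T. \<exists>r>0. \<forall>y\<in>V. N (y - x) < r \<longrightarrow> y \<in> S \<inter> T"
    proof
      fix x assume "x \<in> S \<inter> T"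
      then have "x \<in> S" "x \<in> T" by auto
      obtain r where "r > 0" "\<forall>y\<in>V. N (y - x) < r \<longrightarrow> y \<in> S"
        using S \<open>x \<in> S\<close> by blast
      moreover obtain s where "s > 0" "\<forall>y\<in>V. N (y - x) < s \<longrightarrow> y \<in> T"
        using T \<open>x \<in> T\<close> by blast
      ultimately show "\<exists>r>0. \<forall>y\<in>V. N (y - x) < r \<longrightarrow> y \<in> S \<inter> T"
        by (intro exI[of _ "min r s"]) auto
    qed
  next
    fix \<K> assume "\<forall>K\<in>\<K>. K \<subseteq> V \<and> (\<forall>x\<in>K. \<exists>r>0. \<forall>y\<in>V. N (y - x) < r \<longrightarrow> y \<in> K)"
    note \<K> = this
    then show "\<Union>\<K> \<subseteq> V" by blast
    show "\<forall>x\<in>\<Union>\<K>. \<exists>r>0. \<forall>y\<in>V. N (y - x) < r \<longrightarrow> y \<in> \<Union>\<K>"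
    proof
      fix x assume "x \<in> \<Union>\<K>"
      then obtain K where "K \<in> \<K>" "x \<in> K" by blast
      then obtain r where "r > 0" "\<forall>y\<in>V. N (y - x) < r \<longrightarrow> y \<in> K" using \<K> by blast
      then show "\<exists>r>0. \<forall>y\<in>V. N (y - x) < r \<longrightarrow> y \<in> \<Union>\<K>" using \<open>K \<in> \<K>\<close> by blast
    qed
  qed
  then show ?thesis by (simp add: norm_topology_def)
qed

lemma topspace_norm_topology: "topspace (norm_topology V N) = V"
proof
  show "topspace (norm_topology V N) \<subseteq> V"
    by (auto simp: topspace_def openin_norm_topology)
  have "openin (norm_topology V N) V"
    unfolding openin_norm_topology by (auto intro: exI[of _ 1])
  then show "V \<subseteq> topspace (norm_topology V N)" by (rule openin_subset)
qed

lemma openin_ball: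
  assumes "a \<in> V"
  shows "openin (norm_topology V N) {x\<in>V. N (x - a) < r}"
  unfolding openin_norm_topology
proof (intro conjI ballI)
  fix x assume x: "x \<in> {x\<in>V. N (x - a) < r}"
  have "N (y - a) < r" if "y \<in> V" "N (y - x) < r - N (x - a)" for y
    using diff_triangle[of y x a] that x assms by auto
  then show "\<exists>s>0. \<forall>y\<in>V. N (y - x) < s \<longrightarrow> y \<in> {x\<in>V. N (x - a) < r}"
    using x by (intro exI[of _ "r - N (x - a)"]) auto
qed auto

text \<open>Complements of closed balls; they form the cover in
  \<open>compactin_Inf_eq_0_attained\<close>.\<close>

lemma openin_outside:
  assumes "a \<in> V"
  shows "openin (norm_topology V N) {x\<in>V. r < N (a - x)}"
  unfolding openin_norm_topology
proof (intro conjI ballI)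
  fix x assume x: "x \<in> {x\<in>V. r < N (a - x)}"
  have "r < N (a - y)" if "y \<in> V" "N (y - x) < N (a - x) - r" for y
    using diff_triangle[of a y x] that x assms by auto
  then show "\<exists>s>0. \<forall>y\<in>V. N (y - x) < s \<longrightarrow> y \<in> {x\<in>V. r < N (a - x)}"
    using x by (intro exI[of _ "N (a - x) - r"]) auto
qed auto

section \<open>Compact sets for a seminorm\<close>

lemma compactin_imp_bounded_in:
  assumes "compactin (norm_topology V N) K"
  shows "bounded_in V N K"
proof -
  have KV: "K \<subseteq> V" using assms by (simp add: compactin_def topspace_norm_topology)
  let ?\<U> = "range (\<lambda>n::nat. {x\<in>V. N (x - 0) < real n})"
  have "K \<subseteq> \<Union>?\<U>" using KV reals_Archimedean2 by fastforce
  moreover have "\<forall>U\<in>?\<U>. openin (norm_topology V N) U" using openin_ball[OF zero_mem] by blast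
  ultimately obtain \<F> where \<F>: "finite \<F>" "\<F> \<subseteq> ?\<U>" "K \<subseteq> \<Union>\<F>"
    using assms unfolding compactin_def by meson
  then obtain I where I: "finite I" "\<F> = (\<lambda>n::nat. {x\<in>V. N (x - 0) < real n}) ` I"
    by (meson finite_subset_image)
  \<comment> \<open>For empty \<open>I\<close> the value of \<open>Max I\<close> is unspecified, but
    then \<open>K\<close> is empty as well.\<close>
  have "N x \<le> real (Max I)" if x: "x \<in> K" for x
  proof -
    obtain n where "n \<in> I" "N x < real n" using x \<F>(3) unfolding I(2) by auto
    moreover from this have "n \<le> Max I" using I(1) by simp
    ultimately show ?thesis by linarith
  qed
  then show ?thesis using KV unfolding bounded_in_def by blast
qed

text \<open>Were every point of \<open>K\<close> at positive distance from \<open>a\<close>, the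
  complements of the closed balls of radius \<open>1 / real (Suc n)\<close> around \<open>a\<close>
  would cover \<open>K\<close>. A finite subcover keeps \<open>K\<close> at distance at least
  \<open>1 / real (Suc (Max I))\<close>, against \<open>close\<close>.\<close>

lemma compactin_Inf_eq_0_attained:
  assumes K: "compactin (norm_topology V N) K" and a: "a \<in> V"
    and close: "\<And>\<delta>. \<delta> > 0 \<Longrightarrow> \<exists>y\<in>K. N (a - y) < \<delta>"
  shows "\<exists>y\<in>K. N (a - y) \<le> 0"
proof (rule ccontr)
  assume far: "\<not> ?thesis"
  have KV: "K \<subseteq> V" using K by (simp add: compactin_def topspace_norm_topology)
  let ?U = "\<lambda>n::nat. {x\<in>V. 1 / real (Suc n) < N (a - x)}"
  have "K \<subseteq> \<Union>(range ?U)"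
  proof
    fix y assume y: "y \<in> K"
    then have "0 < N (a - y)" using far by force
    then obtain n where "1 / real (Suc n) < N (a - y)"
      by (rule nat_approx_posE)
    then show "y \<in> \<Union>(range ?U)" using y KV by blast
  qed
  moreover have "\<forall>U\<in>range ?U. openin (norm_topology V N) U" using openin_outside[OF a] by blast
  ultimately obtain \<F> where \<F>: "finite \<F>" "\<F> \<subseteq> range ?U" "K \<subseteq> \<Union>\<F>"
    using K unfolding compactin_def by meson
  then obtain I where I: "finite I" "\<F> = ?U ` I"
    by (meson finite_subset_image)
  obtain y where y: "y \<in> K" "N (a - y) < 1 / real (Suc (Max I))"
    using close[of "1 / real (Suc (Max I))"] by auto
  then obtain n where n: "n \<in> I" "1 / real (Suc n) < N (a - y)"
    using \<F>(3) unfolding I(2) by auto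
  then have "n \<le> Max I" using I(1) by simp
  then have "1 / real (Suc (Max I)) \<le> 1 / real (Suc n)" by (simp add: frac_le)
  then show False using n(2) y(2) by linarith
qed

lemma global_attractor_near_exponential_attractor:
  assumes A: "global_attractor V N S A" and M: "exponential_attractor V N S M" and a: "a \<in> A"
  shows "\<exists>m\<in>M. N (a - m) \<le> 0"
proof (rule compactin_Inf_eq_0_attained)
  have "compactin (norm_topology V N) A" using A by (simp add: global_attractor_def)
  then have bdd: "bounded_in V N A" by (rule compactin_imp_bounded_in)
  then show "a \<in> V" using a by (auto simp: bounded_in_def)
  show "compactin (norm_topology V N) M" using M by (simp add: exponential_attractor_def)
  fix \<delta> :: real assume \<delta>: "\<delta> > 0"
  obtain \<omega> C where \<omega>: "\<omega> > 0"
    and C: "\<And>t. t \<ge> 0 \<Longrightarrow> semidist N (S t ` A) M \<le> ennreal (C * exp (- \<omega> * t))"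
    using M bdd unfolding exponential_attractor_def by meson
  have "((\<lambda>t. C * exp (- \<omega> * t)) \<longlongrightarrow> C * 0) at_top"
  proof (intro tendsto_intros filterlim_compose[OF exp_at_bot])
    show "LIM t at_top. - \<omega> * t :> at_bot"
      using \<omega> by (intro filterlim_tendsto_neg_mult_at_bot[OF tendsto_const _ filterlim_ident]) auto
  qed
  then have "\<forall>\<^sub>F t in at_top. C * exp (- \<omega> * t) < \<delta>"
    using \<delta> by (simp add: order_tendstoD(2))
  then have "\<forall>\<^sub>F t in at_top. t \<ge> 0 \<and> C * exp (- \<omega> * t) < \<delta>"
    by (intro eventually_conj eventually_ge_at_top)
  then obtain t where t: "t \<ge> 0" "C * exp (- \<omega> * t) < \<delta>"
    unfolding eventually_at_top_linorder by blast
  have "S t ` A = A" using A t(1) by (simp add: global_attractor_def)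
  then have "(INF m\<in>M. ennreal (N (a - m))) \<le> semidist N (S t ` A) M"
    unfolding semidist_def using a by (intro SUP_upper2[of a]) auto
  also have "\<dots> < ennreal \<delta>"
    using C[OF t(1)] t(2) \<delta> by (meson ennreal_lessI le_less_trans)
  \<comment> \<open>An infimum over an empty \<open>M\<close> would be top, so the strict bound also
    shows that \<open>M\<close> is nonempty.\<close>
  finally obtain m where "m \<in> M" "ennreal (N (a - m)) < ennreal \<delta>"
    unfolding INF_less_iff by blast
  then show "\<exists>m\<in>M. N (a - m) < \<delta>" by (meson ennreal_leI linorder_not_le)
qed

section \<open>Covering numbers and fractal dimension of sets at distance 0\<close>

lemma covering_number_mono:
  assumes "A \<subseteq> V" "M \<subseteq> V" and near: "\<And>a. a \<in> A \<Longrightarrow> \<exists>m\<in>M. N (a - m) \<le> 0"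
  shows "covering_number V N A r \<le> covering_number V N M r"
  unfolding covering_number_def
\<comment> \<open>The centres and the radius of a cover of \<open>M\<close> are kept: a displacement
  of seminorm 0 does not leave an open ball.\<close>
proof (rule INF_superset_mono)
  show "{C. finite C \<and> C \<subseteq> V \<and> M \<subseteq> (\<Union>c\<in>C. {y\<in>V. N (y - c) < r})}
    \<subseteq> {C. finite C \<and> C \<subseteq> V \<and> A \<subseteq> (\<Union>c\<in>C. {y\<in>V. N (y - c) < r})}"
  proof (intro Collect_mono impI, elim conjE, intro conjI subsetI)
    fix C a
    assume C: "C \<subseteq> V" "M \<subseteq> (\<Union>c\<in>C. {y\<in>V. N (y - c) < r})" and a: "a \<in> A"
    obtain m where m: "m \<in> M" "N (a - m) \<le> 0" using near[OF a] by blast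
    then obtain c where c: "c \<in> C" "N (m - c) < r" using C(2) by blast
    have "N (a - c) \<le> N (a - m) + N (m - c)"
      using a m(1) c(1) C(1) assms by (intro diff_triangle) auto
    then have "N (a - c) < r" using m(2) c(2) by linarith
    then show "a \<in> (\<Union>c\<in>C. {y\<in>V. N (y - c) < r})" using a assms(1) c(1) by blast
  qed auto
qed simp

lemma fractal_dim_mono:
  assumes "A \<subseteq> V" "M \<subseteq> V" and near: "\<And>a. a \<in> A \<Longrightarrow> \<exists>m\<in>M. N (a - m) \<le> 0"
  shows "fractal_dim V N A \<le> fractal_dim V N M"
  unfolding fractal_dim_def
proof (rule Limsup_mono)
  \<comment> \<open>For \<open>r < 1\<close> the denominator \<open>- ln r\<close> is positive, so
    the quotient is monotone in the covering number.\<close>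
  have "eventually (\<lambda>r::real. r \<in> {0<..<1}) (at_right 0)"
    by (rule eventually_at_right_real) simp
  then show "\<forall>\<^sub>F r in at_right 0.
    (case covering_number V N A r of enat n \<Rightarrow> ereal (ln (real n) / - ln r) | \<infinity> \<Rightarrow> \<infinity>)
    \<le> (case covering_number V N M r of enat n \<Rightarrow> ereal (ln (real n) / - ln r) | \<infinity> \<Rightarrow> \<infinity>)"
  proof (eventually_elim)
    case (elim r)
    have le: "covering_number V N A r \<le> covering_number V N M r"
      by (rule covering_number_mono[OF assms])
    show ?case
    proof (cases "covering_number V N M r")
      case (enat m)
      with le obtain n where n: "covering_number V N A r = enat n" "n \<le> m"
        by (metis enat_ile enat_ord_simps(1))
      \<comment> \<open>\<open>ln 0 = 0\<close> covers an empty attractor\<close>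
      have "ln (real n) \<le> ln (real m)"
        using n(2) by (cases "n = 0"; cases "m = 0") auto
      moreover have "0 < - ln r" using elim by simp
      ultimately show ?thesis
        by (simp only: enat n(1) enat.case ereal_less_eq divide_right_mono less_imp_le)
    qed simp
  qed
qed

lemma fractal_dim_global_attractor_le:
  assumes A: "global_attractor V N S A" and M: "exponential_attractor V N S M"
  shows "fractal_dim V N A \<le> fractal_dim V N M"
proof (rule fractal_dim_mono)
  show "A \<subseteq> V" "M \<subseteq> V"
    using A M compactin_subset_topspace[of "norm_topology V N"]
    by (auto simp: global_attractor_def exponential_attractor_def topspace_norm_topology)
qed (rule global_attractor_near_exponential_attractor[OF A M])

end

section \<open>Square integrable functions\<close>

text \<open>Stated for functions and an arbitrary measure, so that it serves both classes under
  \<open>lebesgue\<close> and trace representatives under \<open>surface_measure\<close>.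
  Measurability is a separate conjunct because it does not follow from that of the square.\<close>

definition square_integrable :: "'a measure \<Rightarrow> ('a \<Rightarrow> real) \<Rightarrow> bool" where
  "square_integrable M f \<longleftrightarrow> f \<in> borel_measurable M \<and> integrable M (\<lambda>x. (f x)\<^sup>2)"

lemma square_integrable_mult:
  assumes "square_integrable M f" "square_integrable M g"
  shows "integrable M (\<lambda>x. f x * g x)"
proof (rule Bochner_Integration.integrable_bound)
  show "integrable M (\<lambda>x. (f x)\<^sup>2 + (g x)\<^sup>2)"
    using assms by (auto simp: square_integrable_def)
  show "(\<lambda>x. f x * g x) \<in> borel_measurable M"
    using assms by (auto simp: square_integrable_def)
  have "\<bar>a * b\<bar> \<le> \<bar>a\<^sup>2 + b\<^sup>2\<bar>" for a b :: real
  proof -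
    have "2 * (\<bar>a\<bar> * \<bar>b\<bar>) \<le> a\<^sup>2 + b\<^sup>2"
      using sum_squares_bound[of "\<bar>a\<bar>" "\<bar>b\<bar>"] by simp
    moreover have "0 \<le> \<bar>a\<bar> * \<bar>b\<bar>" by simp
    ultimately show ?thesis unfolding abs_mult by linarith
  qed
  then show "AE x in M. norm (f x * g x) \<le> norm ((f x)\<^sup>2 + (g x)\<^sup>2)"
    by simp
qed

lemma square_integrable_add:
  assumes "square_integrable M f" "square_integrable M g"
  shows "square_integrable M (\<lambda>x. f x + g x)"
  using assms square_integrable_mult[OF assms]
  by (auto simp: square_integrable_def power2_sum mult.assoc)

lemma square_integrable_scale:
  "square_integrable M f \<Longrightarrow> square_integrable M (\<lambda>x. c * f x)"
  by (auto simp: square_integrable_def power_mult_distrib)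

lemma square_integrable_cong_AE:
  assumes "square_integrable M f" "g \<in> borel_measurable M" "AE x in M. g x = f x"
  shows "square_integrable M g"
  unfolding square_integrable_def
proof
  show "integrable M (\<lambda>x. (g x)\<^sup>2)"
    by (rule integrable_cong_AE_imp[of M "\<lambda>x. (f x)\<^sup>2"])
      (use assms in \<open>auto simp: square_integrable_def elim!: eventually_mono\<close>)
qed fact

lemma Cauchy_Schwarz_integral:
  assumes f: "square_integrable M f" and g: "square_integrable M g"
  shows "(LINT x|M. f x * g x)\<^sup>2 \<le> (LINT x|M. (f x)\<^sup>2) * (LINT x|M. (g x)\<^sup>2)"
proof -
  let ?a = "LINT x|M. (f x)\<^sup>2" and ?b = "LINT x|M. f x * g x" and ?c = "LINT x|M. (g x)\<^sup>2"
  have int: "integrable M (\<lambda>x. (f x)\<^sup>2)" "integrable M (\<lambda>x. (g x)\<^sup>2)" "integrable M (\<lambda>x. f x * g x)"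
    using assms square_integrable_mult by (auto simp: square_integrable_def)
  have quad: "0 \<le> s\<^sup>2 * ?a + 2 * s * t * ?b + t\<^sup>2 * ?c" for s t :: real
  proof -
    have "0 \<le> (LINT x|M. (s * f x + t * g x)\<^sup>2)" by simp
    also have "\<dots> = (LINT x|M. s\<^sup>2 * (f x)\<^sup>2 + 2 * s * t * (f x * g x) + t\<^sup>2 * (g x)\<^sup>2)"
      by (intro Bochner_Integration.integral_cong) (auto simp: power2_eq_square algebra_simps)
    also have "\<dots> = s\<^sup>2 * ?a + 2 * s * t * ?b + t\<^sup>2 * ?c"
      using int by simp
    finally show ?thesis .
  qed
  have "0 \<le> ?a" "0 \<le> ?c" by simp_all
  show ?thesis
  proof (cases "?c = 0")
    case True
    have "?b = 0"
    proof (rule ccontr)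
      assume "?b \<noteq> 0"
      \<comment> \<open>For \<open>?c = 0\<close> the form is affine in \<open>t\<close>; this
        \<open>t\<close>, with \<open>s = 1\<close>, gives it the value -1.\<close>
      then have "2 * 1 * (- (?a + 1) / (2 * ?b)) * ?b = - (?a + 1)" by simp
      then show False using quad[of 1 "- (?a + 1) / (2 * ?b)"] True by simp
    qed
    then show ?thesis using True by simp
  next
    case False
    then have c: "?c > 0" using \<open>0 \<le> ?c\<close> by linarith
    \<comment> \<open>The form is minimal where \<open>t / s = - ?b / ?c\<close>; the choice
      \<open>s = ?c\<close>, \<open>t = - ?b\<close> clears the denominator.\<close>
    have "0 \<le> ?c\<^sup>2 * ?a + 2 * ?c * (- ?b) * ?b + (- ?b)\<^sup>2 * ?c" by (rule quad)
    also have "\<dots> = ?c * (?a * ?c - ?b\<^sup>2)" by (simp add: power2_eq_square algebra_simps)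
    finally show ?thesis using c by (simp add: zero_le_mult_iff)
  qed
qed

lemma Minkowski_integral:
  assumes f: "square_integrable M f" and g: "square_integrable M g"
  shows "sqrt (LINT x|M. (f x + g x)\<^sup>2) \<le> sqrt (LINT x|M. (f x)\<^sup>2) + sqrt (LINT x|M. (g x)\<^sup>2)"
proof -
  let ?a = "LINT x|M. (f x)\<^sup>2" and ?b = "LINT x|M. f x * g x" and ?c = "LINT x|M. (g x)\<^sup>2"
  have int: "integrable M (\<lambda>x. (f x)\<^sup>2)" "integrable M (\<lambda>x. (g x)\<^sup>2)" "integrable M (\<lambda>x. f x * g x)"
    using assms square_integrable_mult by (auto simp: square_integrable_def)
  have "(LINT x|M. (f x + g x)\<^sup>2) = ?a + 2 * ?b + ?c"
    using int by (simp add: power2_sum mult.assoc)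
  also have "?b \<le> sqrt ?a * sqrt ?c"
    using real_le_rsqrt[OF Cauchy_Schwarz_integral[OF f g]] by (simp add: real_sqrt_mult)
  then have "?a + 2 * ?b + ?c \<le> (sqrt ?a + sqrt ?c)\<^sup>2"
    by (simp add: power2_sum)
  finally show ?thesis by (intro real_le_lsqrt) auto
qed

section \<open>Smooth functions\<close>

text \<open>Needed for the product rule, where the undifferentiated factor must have its order
  lowered by one.\<close>

lemma Ck_on_SucD: "Ck_on (Suc k) UNIV f \<Longrightarrow> Ck_on k UNIV f"
proof (induction k arbitrary: f)
  case 0
  then show ?case
    by (auto intro!: differentiable_imp_continuous_on simp: differentiable_on_def
        intro: differentiable_at_withinI)
next
  case (Suc k)
  \<comment> \<open>Unfolding a single level leaves \<open>Ck_on (Suc k)\<close> of the partial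
    derivatives intact, as the induction hypothesis requires.\<close>
  have D: "\<forall>x\<in>UNIV. f differentiable (at x)"
    and C: "\<forall>b\<in>Basis. Ck_on (Suc k) UNIV (\<lambda>x. frechet_derivative f (at x) b)"
    using Suc.prems by (subst (asm) Ck_on.simps(2), blast)+
  show ?case using D C Suc.IH by (subst Ck_on.simps(2)) blast
qed

lemma Ck_on_const: "Ck_on k UNIV (\<lambda>x::'a::euclidean_space. c)"
  by (induction k arbitrary: c) (auto simp: frechet_derivative_const)

lemma Ck_on_add:
  assumes "Ck_on k UNIV f" "Ck_on k UNIV g"
  shows "Ck_on k UNIV (\<lambda>x. f x + g x)"
  using assms
proof (induction k arbitrary: f g)
  case 0
  then show ?case by (auto intro: continuous_intros)
next
  case (Suc k)
  have "frechet_derivative (\<lambda>x. f x + g x) (at x)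
      = (\<lambda>h. frechet_derivative f (at x) h + frechet_derivative g (at x) h)" for x
    using Suc.prems
    by (intro frechet_derivative_at[symmetric] has_derivative_add frechet_derivative_works[THEN iffD1]) auto
  then show ?case using Suc by (simp add: differentiable_add)
qed

lemma Ck_on_mult:
  assumes "Ck_on k UNIV f" "Ck_on k UNIV g"
  shows "Ck_on k UNIV (\<lambda>x. f x * g x)"
  using assms
proof (induction k arbitrary: f g)
  case 0
  then show ?case by (auto intro: continuous_intros)
next
  case (Suc k)
  have "frechet_derivative (\<lambda>x. f x * g x) (at x)
      = (\<lambda>h. f x * frechet_derivative g (at x) h + frechet_derivative f (at x) h * g x)" for x
    using Suc.prems
    by (intro frechet_derivative_at[symmetric] has_derivative_mult frechet_derivative_works[THEN iffD1]) auto
  then show ?case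
    using Suc Ck_on_SucD[OF Suc.prems(1)] Ck_on_SucD[OF Suc.prems(2)]
    by (simp add: Ck_on_add)
qed

lemma Ck_on_prod:
  assumes "\<And>i. i \<in> I \<Longrightarrow> Ck_on k UNIV (f i)"
  shows "Ck_on k UNIV (\<lambda>x. \<Prod>i\<in>I. f i x)"
  using assms by (induction I rule: infinite_finite_induct) (auto intro: Ck_on_mult Ck_on_const)

lemma Ck_on_power: "Ck_on k UNIV f \<Longrightarrow> Ck_on k UNIV (\<lambda>x. f x ^ n)"
  by (induction n) (auto intro: Ck_on_mult Ck_on_const)

section \<open>Smooth functions that are positive exactly on a box\<close>

text \<open>The polynomial factor makes the family closed under differentiation, hence its members smooth.\<close>

definition flat :: "real poly \<Rightarrow> real \<Rightarrow> real" where
  "flat p t = (if t > 0 then poly p (1 / t) * exp (- (1 / t)) else 0)"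

lemma poly_div_exp_tendsto_0: "((\<lambda>s::real. poly p s / exp s) \<longlongrightarrow> 0) at_top"
proof -
  have "((\<lambda>s. \<Sum>i\<le>degree p. coeff p i * (s ^ i / exp s)) \<longlongrightarrow> (\<Sum>i\<le>degree p. coeff p i * 0)) at_top"
    by (intro tendsto_intros tendsto_power_div_exp_0)
  then show ?thesis by (simp add: poly_altdef sum_divide_distrib)
qed

text \<open>In the variable \<open>s = 1 / t\<close> the derivative d/dt is -s^2 d/ds, which sends
  p(s) exp(-s) to s^2 (p(s) - p'(s)) exp(-s). At 0 the exponential beats every polynomial in
  \<open>s\<close>.\<close>

lemma flat_has_derivative:
  "(flat p has_real_derivative flat (monom 1 2 * (p - pderiv p)) t) (at t)"
proof -
  consider "t > 0" | "t < 0" | "t = 0" by linarith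
  then show ?thesis
  proof cases
    assume t: "t > 0"
    have "((\<lambda>t. poly p (1 / t) * exp (- (1 / t))) has_real_derivative
        flat (monom 1 2 * (p - pderiv p)) t) (at t)"
      using t
      by (auto intro!: derivative_eq_intros poly_DERIV[THEN DERIV_chain2]
          simp: flat_def poly_monom field_simps power2_eq_square)
    then show ?thesis
      by (rule has_field_derivative_transform_within_open[where S = "{0<..}"])
        (use t in \<open>auto simp: flat_def\<close>)
  next
    assume t: "t < 0"
    have "((\<lambda>t. 0) has_real_derivative 0) (at t)" by simp
    then have "(flat p has_real_derivative 0) (at t)"
      by (rule has_field_derivative_transform_within_open[where S = "{..<0}"])
        (use t in \<open>auto simp: flat_def\<close>)
    then show ?thesis using t by (simp add: flat_def)
  next
    assume t: "t = 0"
    have "((\<lambda>h. flat p h / h) \<longlongrightarrow> 0) (at_right 0)"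
    proof (rule Lim_transform_eventually)
      \<comment> \<open>The right difference quotient is s p(s) / exp s with
        \<open>s = inverse h\<close>; \<open>pCons 0 p\<close> is the polynomial s p(s).\<close>
      show "((\<lambda>h. poly (pCons 0 p) (inverse h) / exp (inverse h)) \<longlongrightarrow> 0) (at_right (0::real))"
        by (rule filterlim_compose[OF poly_div_exp_tendsto_0 filterlim_inverse_at_top_right])
      show "\<forall>\<^sub>F h in at_right 0. poly (pCons 0 p) (inverse h) / exp (inverse h) = flat p h / h"
        using eventually_at_right_less[of "0::real"]
        by eventually_elim (simp add: flat_def exp_minus field_simps)
    qed
    moreover have "((\<lambda>h. flat p h / h) \<longlongrightarrow> 0) (at_left 0)"
    proof (rule Lim_transform_eventually)
      show "\<forall>\<^sub>F h in at_left 0. 0 = flat p h / h"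
        using eventually_at_left_real[of "- 1" "0::real"]
        by (simp add: eventually_mono flat_def)
    qed simp
    ultimately have "((\<lambda>h. flat p h / h) \<longlongrightarrow> 0) (at 0)"
      by (simp add: filterlim_split_at)
    then show ?thesis using t by (simp add: DERIV_def flat_def)
  qed
qed

text \<open>The induction needs \<open>c\<close> and \<open>p\<close> arbitrary: a derivative in
  direction \<open>b\<close> multiplies \<open>c\<close> by \<open>a \<bullet> b\<close> and
  replaces \<open>p\<close> by the polynomial of \<open>flat_has_derivative\<close>.\<close>

lemma Ck_on_flat_affine:
  "Ck_on k UNIV (\<lambda>x::'a::euclidean_space. c * flat p (a \<bullet> x + d))"
proof (induction k arbitrary: c p)
  case 0
  have "continuous_on UNIV (flat p)"
    using DERIV_isCont[OF flat_has_derivative] by (intro continuous_at_imp_continuous_on) simp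
  then have "continuous_on UNIV (\<lambda>x::'a. flat p (a \<bullet> x + d))"
    by (rule continuous_on_compose2) (intro continuous_intros, simp)
  then show ?case by (simp add: continuous_on_mult)
next
  case (Suc k)
  let ?q = "monom 1 2 * (p - pderiv p)"
  have *: "((\<lambda>x. c * flat p (a \<bullet> x + d)) has_derivative (\<lambda>h. c * ((a \<bullet> h) * flat ?q (a \<bullet> x + d)))) (at x)" for x
  proof -
    have "((\<lambda>x. flat p (a \<bullet> x + d)) has_derivative (\<lambda>h. (a \<bullet> h) * flat ?q (a \<bullet> x + d))) (at x)"
      by (rule DERIV_compose_FDERIV[OF flat_has_derivative]) (auto intro!: derivative_eq_intros)
    then show ?thesis by (rule has_derivative_mult_right)
  qed
  have "frechet_derivative (\<lambda>x. c * flat p (a \<bullet> x + d)) (at x) b = (c * (a \<bullet> b)) * flat ?q (a \<bullet> x + d)" for x b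
    using frechet_derivative_at[OF *[of x], symmetric] by simp
  moreover have "(\<lambda>x. c * flat p (a \<bullet> x + d)) differentiable (at x)" for x
    using * by (auto simp: differentiable_def)
  ultimately show ?case using Suc by simp
qed

text \<open>\<open>flat 1\<close> is the classical exp(-1/t), cut off at 0. It is evaluated at the
  signed distances of \<open>x\<close> from the two faces in each coordinate, and all of these are
  positive exactly inside the open box.\<close>

definition box_bump :: "'a::euclidean_space \<Rightarrow> 'a \<Rightarrow> 'a \<Rightarrow> real" where
  "box_bump l u x = (\<Prod>b\<in>Basis. flat 1 (b \<bullet> x - b \<bullet> l) * flat 1 (b \<bullet> u - b \<bullet> x))"

lemma Ck_on_box_bump: "Ck_on k UNIV (box_bump l u)"
proof -
  have "Ck_on k UNIV (\<lambda>x. flat 1 (b \<bullet> x - b \<bullet> l))" "Ck_on k UNIV (\<lambda>x. flat 1 (b \<bullet> u - b \<bullet> x))"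
    for b :: 'a
    using Ck_on_flat_affine[of k 1 1 b "- (b \<bullet> l)"] Ck_on_flat_affine[of k 1 1 "- b" "b \<bullet> u"]
    by (simp_all add: algebra_simps)
  then show ?thesis
    unfolding box_bump_def by (intro Ck_on_prod Ck_on_mult)
qed

lemma box_bump_bounds: "0 \<le> box_bump l u x" "box_bump l u x \<le> 1"
proof -
  have "0 \<le> flat 1 t" "flat 1 t \<le> 1" for t by (auto simp: flat_def)
  then have "0 \<le> flat 1 s * flat 1 t \<and> flat 1 s * flat 1 t \<le> 1" for s t
    by (simp add: mult_le_one)
  then show "0 \<le> box_bump l u x" "box_bump l u x \<le> 1"
    unfolding box_bump_def by (simp_all add: prod_nonneg prod_le_1)
qed

lemma box_bump_eq_0_iff: "box_bump l u x = 0 \<longleftrightarrow> x \<notin> box l u"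
  by (auto simp: box_bump_def flat_def mem_box inner_commute)

text \<open>If \<open>0 \<le> \<phi> \<le> 1\<close>, then \<open>1 - (1 - \<phi>)\<^sup>n\<close> tends boundedly to the indicator of \<open>{\<phi> > 0}\<close>,
  so indicators of boxes are approximated without mollifiers.\<close>

definition box_approx :: "R3 \<Rightarrow> R3 \<Rightarrow> nat \<Rightarrow> R3 \<Rightarrow> real" where
  "box_approx l u n x = 1 - (1 - box_bump l u x) ^ n"

lemma box_approx_bounds: "0 \<le> box_approx l u n x" "box_approx l u n x \<le> 1"
  using box_bump_bounds[of l u x] by (auto simp: box_approx_def power_le_one)

lemma Ck_on_box_approx: "Ck_on k UNIV (box_approx l u n)"
proof -
  have "Ck_on k UNIV (\<lambda>x. 1 + (-1) * (1 + (-1) * box_bump l u x) ^ n)"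
    by (intro Ck_on_add Ck_on_mult Ck_on_power Ck_on_const Ck_on_box_bump)
  then show ?thesis by (simp add: box_approx_def[abs_def])
qed

text \<open>Where the bump vanishes, so does \<open>1 - (1 - 0) ^ n\<close>. The closure of the
  support may reach the faces, hence the hypothesis on the closed box.\<close>

lemma box_approx_test_function:
  assumes "cbox l u \<subseteq> \<Omega>"
  shows "box_approx l u n \<in> test_functions \<Omega>"
proof -
  have "{x. box_approx l u n x \<noteq> 0} \<subseteq> cbox l u"
  proof
    fix x assume "x \<in> {x. box_approx l u n x \<noteq> 0}"
    then have "box_bump l u x \<noteq> 0" by (auto simp: box_approx_def)
    then show "x \<in> cbox l u" using box_subset_cbox[of l u] by (auto simp: box_bump_eq_0_iff)
  qed
  then have "closure {x. box_approx l u n x \<noteq> 0} \<subseteq> cbox l u"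
    by (rule closure_minimal) (rule closed_cbox)
  moreover from this have "compact (closure {x. box_approx l u n x \<noteq> 0})"
    by (simp add: compact_eq_bounded_closed bounded_subset[OF bounded_cbox])
  ultimately show ?thesis
    using assms Ck_on_box_approx by (auto simp: test_functions_def)
qed

lemma box_approx_tendsto: "(\<lambda>n. box_approx l u n x) \<longlonglongrightarrow> indicator (box l u) x"
proof (cases "x \<in> box l u")
  case True
  then have "box_bump l u x \<noteq> 0" by (simp add: box_bump_eq_0_iff)
  then have "(\<lambda>n. (1 - box_bump l u x) ^ n) \<longlonglongrightarrow> 0"
    using box_bump_bounds[of l u x] by (intro LIMSEQ_power_zero) (simp add: abs_if)
  then have "(\<lambda>n. 1 - (1 - box_bump l u x) ^ n) \<longlonglongrightarrow> 1 - 0"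
    by (rule tendsto_diff[OF tendsto_const])
  then show ?thesis using True by (simp add: box_approx_def)
next
  case False
  then show ?thesis by (simp add: box_approx_def box_bump_eq_0_iff[THEN iffD2])
qed

section \<open>The fundamental lemma of the calculus of variations\<close>

text \<open>A pi-lambda argument: boxes are an intersection-stable generator of the Borel sets, and
  the sets over which \<open>h\<close> integrates to 0 form a Dynkin system. An integrable function
  whose integral over every measurable set is 0 vanishes almost everywhere.\<close>

lemma AE_0_if_box_integrals_0:
  fixes h :: "'a::euclidean_space \<Rightarrow> real"
  assumes int: "integrable lborel h" and box: "\<And>l u. (LINT x:box l u|lborel. h x) = 0"
  shows "AE x in lborel. h x = 0"
proof (rule sigma_finite_measure.density_zero[OF sigma_finite_lborel int])
  fix A :: "'a set" assume "A \<in> sets lborel"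
  have setint: "set_integrable lborel A h" if "A \<in> sets borel" for A
    unfolding set_integrable_def using int that by (intro integrable_mult_indicator) auto
  \<comment> \<open>The complement step needs the whole space, which is no box but an increasing
    union of boxes.\<close>
  have UNIV: "(LINT x:UNIV|lborel. h x) = 0"
  proof -
    let ?B = "\<lambda>n::nat. box (- (real n *\<^sub>R One)) (real n *\<^sub>R One) :: 'a set"
    have "incseq ?B"
      unfolding incseq_def by (force simp: mem_box)
    then have "(\<lambda>n. LINT x:?B n|lborel. h x) \<longlonglongrightarrow> (LINT x:(\<Union>n. ?B n)|lborel. h x)"
      by (intro set_integral_cont_up setint) auto
    then show ?thesis by (simp add: box UN_box_eq_UNIV LIMSEQ_const_iff)
  qed
  let ?G = "range (\<lambda>(a, b). box a b :: 'a set)"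
  have sets: "sigma_sets UNIV ?G = sets borel"
    by (simp add: borel_eq_box)
  have "Int_stable ?G" by (auto simp: Int_stable_def box_Int_box)
  moreover have "?G \<subseteq> Pow UNIV" by simp
  moreover have "A \<in> sigma_sets UNIV ?G" using \<open>A \<in> sets lborel\<close> sets by simp
  ultimately show "(LINT x:A|lborel. h x) = 0"
  proof (induction rule: sigma_sets_induct_disjoint)
    case (compl A)
    have A: "A \<in> sets borel" using compl(1) sets by simp
    have "(LINT x:UNIV|lborel. h x) = (LINT x:A \<union> (UNIV - A)|lborel. h x)" by simp
    also have "\<dots> = (LINT x:A|lborel. h x) + (LINT x:UNIV - A|lborel. h x)"
      using A by (intro set_integral_Un setint) auto
    finally show ?case using UNIV compl(2) by simp
  next
    case (union A)
    have A: "\<And>i. A i \<in> sets borel" using union(2) sets by auto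
    have "(LINT x:(\<Union>i. A i)|lborel. h x) = (\<Sum>i. (LINT x:A i|lborel. h x))"
    proof (rule lebesgue_integral_countable_add)
      show "A i \<inter> A j = {}" if "i \<noteq> j" for i j
        using union(1) that by (auto simp: disjoint_family_on_def)
      show "set_integrable lborel (\<Union>i. A i) h" using A by (intro setint) auto
    qed (use A in auto)
    then show ?case using union(3) by simp
  qed (use box in \<open>auto simp: set_lebesgue_integral_def\<close>)
qed

text \<open>The test functions \<open>box_approx l u n\<close> lie between 0 and 1 and converge to
  the indicator of the open box; dominated convergence with majorant \<open>\<bar>?g x\<bar>\<close>
  carries the vanishing integrals to the limit.\<close>

lemma box_integral_0_if_test_integrals_0:
  assumes g: "set_integrable lebesgue \<Omega> g"
    and test: "\<And>\<phi>. \<phi> \<in> test_functions \<Omega> \<Longrightarrow> (LINT x:\<Omega>|lebesgue. g x * \<phi> x) = 0"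
    and sub: "cbox l u \<subseteq> \<Omega>"
  shows "(LINT x:box l u|lebesgue. g x) = 0"
proof -
  let ?g = "\<lambda>x. indicator \<Omega> x * g x"
  have g': "integrable lebesgue ?g" using g by (simp add: set_integrable_def)
  then have meas: "?g \<in> borel_measurable lebesgue" by simp
  have box_meas: "box_approx l u n \<in> borel_measurable lebesgue" for n
  proof -
    have "continuous_on UNIV (box_approx l u n)" using Ck_on_box_approx[of 0] by simp
    then have "box_approx l u n \<in> borel_measurable borel"
      by (rule borel_measurable_continuous_onI)
    then show ?thesis by (simp add: measurable_completion)
  qed
  have "(\<lambda>n. LINT x|lebesgue. ?g x * box_approx l u n x)
      \<longlonglongrightarrow> (LINT x|lebesgue. ?g x * indicator (box l u) x)"
  proof (rule integral_dominated_convergence)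
    show "integrable lebesgue (\<lambda>x. \<bar>?g x\<bar>)" using g' by (rule integrable_abs)
    show "(\<lambda>x. ?g x * box_approx l u n x) \<in> borel_measurable lebesgue" for n
      using meas box_meas by (rule borel_measurable_times)
    show "(\<lambda>x. ?g x * indicator (box l u) x) \<in> borel_measurable lebesgue"
      using meas by (rule borel_measurable_times) (intro borel_measurable_indicator, simp)
    show "AE x in lebesgue. (\<lambda>n. ?g x * box_approx l u n x) \<longlonglongrightarrow> ?g x * indicator (box l u) x"
      by (intro always_eventually allI tendsto_mult tendsto_const box_approx_tendsto)
    have "\<bar>?g x\<bar> * \<bar>box_approx l u n x\<bar> \<le> \<bar>?g x\<bar>" for x n
      using box_approx_bounds[of l u n x] by (intro mult_left_le) auto
    then show "AE x in lebesgue. norm (?g x * box_approx l u n x) \<le> \<bar>?g x\<bar>" for n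
      by (simp add: abs_mult)
  qed
  moreover have "(LINT x|lebesgue. ?g x * box_approx l u n x) = 0" for n
    using test[OF box_approx_test_function[OF sub, of n]]
    by (simp add: set_lebesgue_integral_def mult.assoc)
  ultimately have "(LINT x|lebesgue. ?g x * indicator (box l u) x) = 0"
    by (simp add: LIMSEQ_const_iff)
  moreover have "?g x * indicator (box l u) x = indicator (box l u) x * g x" for x
    using sub box_subset_cbox[of l u] by (auto simp: indicator_def)
  ultimately show ?thesis by (simp add: set_lebesgue_integral_def)
qed

text \<open>\<open>AE_0_if_box_integrals_0\<close> speaks of functions integrable over the whole
  space for \<open>lborel\<close>, while \<open>g\<close> is integrable on \<open>\<Omega>\<close>
  only, and for \<open>lebesgue\<close>. So \<open>g\<close> is cut off to a box inside
  \<open>\<Omega>\<close> and replaced by a Borel function; countably many such boxes exhaust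
  \<open>\<Omega>\<close>.\<close>

lemma AE_0_if_test_integrals_0:
  assumes "open \<Omega>" and g: "set_integrable lebesgue \<Omega> g"
    and test: "\<And>\<phi>. \<phi> \<in> test_functions \<Omega> \<Longrightarrow> (LINT x:\<Omega>|lebesgue. g x * \<phi> x) = 0"
  shows "AE x in lebesgue. x \<in> \<Omega> \<longrightarrow> g x = 0"
proof -
  have local: "AE x in lebesgue. x \<in> cbox a b \<longrightarrow> g x = 0" if sub: "cbox a b \<subseteq> \<Omega>" for a b
  proof -
    let ?h = "\<lambda>x. indicator (box a b) x * g x"
    have h: "integrable lebesgue ?h"
    proof -
      have "set_integrable lebesgue (box a b) g"
        using g by (rule set_integrable_subset) (use sub box_subset_cbox[of a b] in auto)
      then show ?thesis by (simp add: set_integrable_def)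
    qed
    then have "?h \<in> borel_measurable lebesgue" by simp
    then obtain h' where h': "h' \<in> borel_measurable lborel" "AE x in lborel. ?h x = h' x"
      using completion_ex_borel_measurable_real by blast
    then have h'2: "h' \<in> borel_measurable lebesgue" "AE x in lebesgue. ?h x = h' x"
      by (auto intro: measurable_completion AE_completion)
    have "integrable lebesgue h'"
      using h h'2 by (rule integrable_cong_AE_imp)
    then have int: "integrable lborel h'"
      using h'(1) by (simp add: integrable_completion)
    have "AE x in lborel. h' x = 0"
    proof (rule AE_0_if_box_integrals_0[OF int])
      fix l u :: R3
      have "(LINT x:box l u|lborel. h' x) = (LINT x:box l u|lebesgue. h' x)"
        unfolding set_lebesgue_integral_def using h'(1) by (subst integral_completion) auto
      also have "\<dots> = (LINT x:box l u|lebesgue. ?h x)"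
        unfolding set_lebesgue_integral_def
      proof (rule integral_cong_AE)
        show "(\<lambda>x. indicat_real (box l u) x *\<^sub>R ?h x) \<in> borel_measurable lebesgue"
          using \<open>?h \<in> borel_measurable lebesgue\<close> by (intro borel_measurable_scaleR borel_measurable_indicator) auto
        show "(\<lambda>x. indicat_real (box l u) x *\<^sub>R h' x) \<in> borel_measurable lebesgue"
          using h'2(1) by (intro borel_measurable_scaleR borel_measurable_indicator) auto
      qed (use h'2(2) in \<open>auto elim!: eventually_mono\<close>)
      also have "\<dots> = (LINT x:box l u \<inter> box a b|lebesgue. g x)"
        unfolding set_lebesgue_integral_def
        by (intro Bochner_Integration.integral_cong) (auto simp: indicator_def)
      also have "\<dots> = 0"
      proof -
        \<comment> \<open>One pair must serve both intersections: the open box is the region of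
          integration, the closed one certifies containment in \<open>\<Omega>\<close>.\<close>
        obtain l' u' where *: "box l u \<inter> box a b = box l' u'" "cbox l u \<inter> cbox a b = cbox l' u'"
          using box_Int_box[of l u a b] Int_interval[of l u a b] by blast
        then show ?thesis
          using box_integral_0_if_test_integrals_0[OF g test, of l' u'] sub by (metis Int_lower2 order_trans)
      qed
      finally show "(LINT x:box l u|lborel. h' x) = 0" .
    qed
    then have "AE x in lebesgue. h' x = 0" by (rule AE_completion)
    \<comment> \<open>The faces are a null set; this passes from the open box, where
      \<open>?h\<close> equals \<open>g\<close>, to the closed boxes that exhaust
      \<open>\<Omega>\<close>.\<close>
    moreover have "AE x in lebesgue. x \<notin> cbox a b - box a b"
      using null_sets_cbox_Diff_box by (intro AE_not_in null_sets_completionI)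
    ultimately show ?thesis using h'2(2)
      by eventually_elim (auto simp: indicator_def split: if_splits)
  qed
  obtain \<D> where \<D>: "countable \<D>" "\<D> \<subseteq> Pow \<Omega>" "\<And>X. X \<in> \<D> \<Longrightarrow> \<exists>a b. X = cbox a b" "\<Union>\<D> = \<Omega>"
    using open_countable_Union_open_cbox[OF \<open>open \<Omega>\<close>] by metis
  have "AE x in lebesgue. \<forall>X\<in>\<D>. x \<in> X \<longrightarrow> g x = 0"
  proof (rule AE_ball_countable'[OF _ \<D>(1)])
    fix X assume "X \<in> \<D>"
    moreover from this have "X \<subseteq> \<Omega>" using \<D>(2) by blast
    ultimately obtain a b where "X = cbox a b" "cbox a b \<subseteq> \<Omega>" using \<D>(3) by metis
    then show "AE x in lebesgue. x \<in> X \<longrightarrow> g x = 0" using local by simp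
  qed
  then show ?thesis
  proof (rule eventually_mono)
    fix x assume "\<forall>X\<in>\<D>. x \<in> X \<longrightarrow> g x = 0"
    then show "x \<in> \<Omega> \<longrightarrow> g x = 0" unfolding \<D>(4)[symmetric] by blast
  qed
qed

section \<open>Combining seminorms\<close>

lemma seminormed_subspace_L2_set:
  assumes "subspace V" and N: "\<And>i. i \<in> I \<Longrightarrow> seminormed_subspace V (N i)"
  shows "seminormed_subspace V (\<lambda>x. L2_set (\<lambda>i. N i x) I)"
proof
  fix x y assume xy: "x \<in> V" "y \<in> V"
  have "L2_set (\<lambda>i. N i (x + y)) I \<le> L2_set (\<lambda>i. N i x + N i y) I"
    using N xy assms(1)
    by (intro L2_set_mono)
      (auto intro: seminormed_subspace.triangle seminormed_subspace.nonneg subspace_add)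
  also have "\<dots> \<le> L2_set (\<lambda>i. N i x) I + L2_set (\<lambda>i. N i y) I"
    by (rule L2_set_triangle_ineq)
  finally show "L2_set (\<lambda>i. N i (x + y)) I \<le> L2_set (\<lambda>i. N i x) I + L2_set (\<lambda>i. N i y) I" .
next
  fix x c assume x: "x \<in> V"
  have "L2_set (\<lambda>i. N i (c *\<^sub>R x)) I = L2_set (\<lambda>i. \<bar>c\<bar> * N i x) I"
    using N x by (intro L2_set_cong) (auto intro: seminormed_subspace.homogeneous)
  then show "L2_set (\<lambda>i. N i (c *\<^sub>R x)) I = \<bar>c\<bar> * L2_set (\<lambda>i. N i x) I"
    by (simp add: L2_set_right_distrib)
qed fact

lemma seminormed_subspace_sqrt_sum_squares:
  assumes "seminormed_subspace V N" "seminormed_subspace V N'"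
  shows "seminormed_subspace V (\<lambda>x. sqrt ((N x)\<^sup>2 + (N' x)\<^sup>2))"
proof -
  \<comment> \<open>A pair of seminorms is a family indexed by \<open>bool\<close>.\<close>
  have "seminormed_subspace V (\<lambda>x. if i then N x else N' x)" for i
    using assms by (cases i) simp_all
  then have "seminormed_subspace V (\<lambda>x. L2_set (\<lambda>i. if i then N x else N' x) UNIV)"
    using assms by (intro seminormed_subspace_L2_set) (simp_all add: seminormed_subspace.subspace)
  then show ?thesis by (simp add: L2_set_def UNIV_bool add.commute)
qed

text \<open>Linearity of \<open>L\<close> is asked for on \<open>V\<close> only, since
  \<open>weak_deriv\<close> is shown to be linear just on \<open>H1\<close>.\<close>

lemma seminormed_subspace_comp:
  assumes "seminormed_subspace W N" "subspace V"
    and "\<And>x. x \<in> V \<Longrightarrow> L x \<in> W"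
    and "\<And>x y. x \<in> V \<Longrightarrow> y \<in> V \<Longrightarrow> L (x + y) = L x + L y"
    and "\<And>x c. x \<in> V \<Longrightarrow> L (c *\<^sub>R x) = c *\<^sub>R L x"
  shows "seminormed_subspace V (\<lambda>x. N (L x))"
  using assms
  by unfold_locales
    (simp_all add: seminormed_subspace.triangle seminormed_subspace.homogeneous)

lemma seminormed_subspace_scale:
  assumes "seminormed_subspace V N" "0 \<le> r"
  shows "seminormed_subspace V (\<lambda>x. r * N x)"
proof -
  interpret seminormed_subspace V N by fact
  show ?thesis
    using assms(2) triangle homogeneous subspace
    by unfold_locales (auto simp: distrib_left[symmetric] intro: mult_left_mono)
qed

section \<open>Representatives\<close>

text \<open>The quotient is partial: \<open>ae_rel\<close> is reflexive exactly on the measurable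
  functions, so every representative is one of them.\<close>

lemma rep_ae_fun_measurable: "rep_ae_fun u \<in> borel_measurable lebesgue"
  using Quotient_rep_reflp[OF Quotient_ae_fun, of u] by (simp add: ae_rel_def)

lemma rep_abs_ae_fun:
  assumes "f \<in> borel_measurable lebesgue"
  shows "AE x in lebesgue. rep_ae_fun (abs_ae_fun f) x = f x"
  using Quotient_rep_abs[OF Quotient_ae_fun, of f] assms by (simp add: ae_rel_def)

text \<open>The representative of a sum is chosen anew, hence agreement only almost
  everywhere.\<close>

lemma rep_ae_fun_plus: "AE x in lebesgue. rep_ae_fun (u + v) x = rep_ae_fun u x + rep_ae_fun v x"
  unfolding plus_ae_fun_def using rep_ae_fun_measurable by (auto intro!: rep_abs_ae_fun)

lemma rep_ae_fun_scaleR: "AE x in lebesgue. rep_ae_fun (c *\<^sub>R u) x = c * rep_ae_fun u x"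
  unfolding scaleR_ae_fun_def using rep_ae_fun_measurable by (auto intro!: rep_abs_ae_fun)

lemma rep_ae_fun_zero: "AE x in lebesgue. rep_ae_fun 0 x = 0"
  unfolding zero_ae_fun_def by (auto intro!: rep_abs_ae_fun)

lemma ae_fun_eqI:
  assumes "AE x in lebesgue. rep_ae_fun u x = rep_ae_fun v x"
  shows "u = v"
  using Quotient_rel_rep[OF Quotient_ae_fun, of u v] assms rep_ae_fun_measurable
  by (simp add: ae_rel_def)

section \<open>The seminorm of the phase space\<close>

lemma L2_square_integrable: "u \<in> L2 \<Omega> \<Longrightarrow> square_integrable lebesgue (rep_ae_fun u)"
  by (simp add: L2_def square_integrable_def rep_ae_fun_measurable)

lemma L2_AE_outside: "u \<in> L2 \<Omega> \<Longrightarrow> AE x in lebesgue. x \<notin> \<Omega> \<longrightarrow> rep_ae_fun u x = 0"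
  by (simp add: L2_def)

lemma L2_I:
  "square_integrable lebesgue (rep_ae_fun u) \<Longrightarrow>
    AE x in lebesgue. x \<notin> \<Omega> \<longrightarrow> rep_ae_fun u x = 0 \<Longrightarrow> u \<in> L2 \<Omega>"
  by (simp add: L2_def square_integrable_def)

lemma subspace_L2: "subspace (L2 \<Omega>)"
proof (rule subspaceI)
  show "0 \<in> L2 \<Omega>"
  proof (rule L2_I)
    show "square_integrable lebesgue (rep_ae_fun 0)"
      by (rule square_integrable_cong_AE[OF _ rep_ae_fun_measurable rep_ae_fun_zero])
        (simp add: square_integrable_def)
  qed (use rep_ae_fun_zero in \<open>auto elim: eventually_mono\<close>)
  fix u v assume uv: "u \<in> L2 \<Omega>" "v \<in> L2 \<Omega>"
  show "u + v \<in> L2 \<Omega>"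
  proof (rule L2_I)
    show "square_integrable lebesgue (rep_ae_fun (u + v))"
      by (rule square_integrable_cong_AE[OF _ rep_ae_fun_measurable rep_ae_fun_plus])
        (intro square_integrable_add L2_square_integrable[OF uv(1)] L2_square_integrable[OF uv(2)])
    show "AE x in lebesgue. x \<notin> \<Omega> \<longrightarrow> rep_ae_fun (u + v) x = 0"
      using uv[THEN L2_AE_outside] rep_ae_fun_plus[of u v] by eventually_elim auto
  qed
next
  fix c u assume u: "u \<in> L2 \<Omega>"
  show "c *\<^sub>R u \<in> L2 \<Omega>"
  proof (rule L2_I)
    show "square_integrable lebesgue (rep_ae_fun (c *\<^sub>R u))"
      by (rule square_integrable_cong_AE[OF _ rep_ae_fun_measurable rep_ae_fun_scaleR])
        (intro square_integrable_scale L2_square_integrable[OF u])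
    show "AE x in lebesgue. x \<notin> \<Omega> \<longrightarrow> rep_ae_fun (c *\<^sub>R u) x = 0"
      using L2_AE_outside[OF u] rep_ae_fun_scaleR[of c u] by eventually_elim auto
  qed
qed

text \<open>Integrating over the whole space instead of \<open>\<Omega>\<close> makes
  \<open>Minkowski_integral\<close> for \<open>lebesgue\<close> applicable.\<close>

lemma L2_norm_eq:
  assumes "u \<in> L2 \<Omega>" "\<Omega> \<in> sets lebesgue"
  shows "L2_norm \<Omega> u = sqrt (LINT x|lebesgue. (rep_ae_fun u x)\<^sup>2)"
proof -
  have [measurable]: "rep_ae_fun u \<in> borel_measurable lebesgue" by (rule rep_ae_fun_measurable)
  have [measurable]: "\<Omega> \<in> sets lebesgue" by fact
  have "(LINT x:\<Omega>|lebesgue. (rep_ae_fun u x)\<^sup>2) = (LINT x|lebesgue. (rep_ae_fun u x)\<^sup>2)"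
    unfolding set_lebesgue_integral_def
  proof (rule integral_cong_AE)
    show "AE x in lebesgue. indicat_real \<Omega> x *\<^sub>R (rep_ae_fun u x)\<^sup>2 = (rep_ae_fun u x)\<^sup>2"
      using L2_AE_outside[OF assms(1)] by eventually_elim (auto simp: indicator_def)
  qed measurable
  then show ?thesis by (simp add: L2_norm_def)
qed

lemma seminormed_subspace_L2:
  assumes "\<Omega> \<in> sets lebesgue"
  shows "seminormed_subspace (L2 \<Omega>) (L2_norm \<Omega>)"
proof
  fix u v assume uv: "u \<in> L2 \<Omega>" "v \<in> L2 \<Omega>"
  have [measurable]: "rep_ae_fun w \<in> borel_measurable lebesgue" for w by (rule rep_ae_fun_measurable)
  have "(LINT x|lebesgue. (rep_ae_fun (u + v) x)\<^sup>2)
      = (LINT x|lebesgue. (rep_ae_fun u x + rep_ae_fun v x)\<^sup>2)"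
    by (rule integral_cong_AE, measurable) (use rep_ae_fun_plus[of u v] in \<open>auto elim: eventually_mono\<close>)
  then show "L2_norm \<Omega> (u + v) \<le> L2_norm \<Omega> u + L2_norm \<Omega> v"
    using Minkowski_integral[OF uv[THEN L2_square_integrable]] uv assms
    by (simp add: L2_norm_eq subspace_add subspace_L2)
next
  fix c u assume u: "u \<in> L2 \<Omega>"
  have [measurable]: "rep_ae_fun w \<in> borel_measurable lebesgue" for w by (rule rep_ae_fun_measurable)
  have "(LINT x|lebesgue. (rep_ae_fun (c *\<^sub>R u) x)\<^sup>2) = (LINT x|lebesgue. c\<^sup>2 * (rep_ae_fun u x)\<^sup>2)"
    by (rule integral_cong_AE, measurable)
      (use rep_ae_fun_scaleR[of c u] in \<open>auto simp: power_mult_distrib elim: eventually_mono\<close>)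
  then show "L2_norm \<Omega> (c *\<^sub>R u) = \<bar>c\<bar> * L2_norm \<Omega> u"
    using u assms by (simp add: L2_norm_eq subspace_scale subspace_L2 real_sqrt_mult)
qed (rule subspace_L2)

text \<open>A bounded \<open>\<Omega>\<close> lies in a compact box, on which the continuous
  \<open>\<psi>\<close> is square integrable. In use, \<open>\<psi>\<close> is a test function, one
  of its partial derivatives, or the constant 1.\<close>

lemma L2_times_continuous_integrable:
  assumes \<Omega>: "\<Omega> \<in> sets lebesgue" "bounded \<Omega>" and u: "u \<in> L2 \<Omega>" and \<psi>: "continuous_on UNIV \<psi>"
  shows "set_integrable lebesgue \<Omega> (\<lambda>x. rep_ae_fun u x * \<psi> x)"
proof -
  obtain a b where ab: "\<Omega> \<subseteq> cbox a b"
    using bounded_subset_cbox_symmetric[OF \<Omega>(2)] by blast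
  have "square_integrable lebesgue (\<lambda>x. indicator \<Omega> x * \<psi> x)"
    unfolding square_integrable_def
  proof
    have "\<psi> \<in> borel_measurable lebesgue"
      using borel_measurable_continuous_onI[OF \<psi>] by (simp add: measurable_completion)
    then show "(\<lambda>x. indicator \<Omega> x * \<psi> x) \<in> borel_measurable lebesgue"
      using \<Omega>(1) by (intro borel_measurable_times borel_measurable_indicator)
    have "set_integrable lebesgue (cbox a b) (\<lambda>x. (\<psi> x)\<^sup>2)"
      using \<psi> by (intro absolutely_integrable_continuous continuous_intros)
        (auto intro: continuous_on_subset)
    then have "set_integrable lebesgue \<Omega> (\<lambda>x. (\<psi> x)\<^sup>2)"
      using \<Omega>(1) ab by (rule set_integrable_subset)
    moreover have "(indicator \<Omega> x * \<psi> x)\<^sup>2 = indicator \<Omega> x *\<^sub>R (\<psi> x)\<^sup>2" for x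
      by (simp add: indicator_def)
    ultimately show "integrable lebesgue (\<lambda>x. (indicator \<Omega> x * \<psi> x)\<^sup>2)"
      by (simp add: set_integrable_def)
  qed
  from square_integrable_mult[OF L2_square_integrable[OF u] this] show ?thesis
    by (simp add: set_integrable_def mult_ac)
qed

lemma L2_pairing_add:
  assumes \<Omega>: "\<Omega> \<in> sets lebesgue" "bounded \<Omega>" and uv: "u \<in> L2 \<Omega>" "v \<in> L2 \<Omega>"
    and \<psi>: "continuous_on UNIV \<psi>"
  shows "(LINT x:\<Omega>|lebesgue. rep_ae_fun (u + v) x * \<psi> x)
    = (LINT x:\<Omega>|lebesgue. rep_ae_fun u x * \<psi> x) + (LINT x:\<Omega>|lebesgue. rep_ae_fun v x * \<psi> x)"
proof -
  have [measurable]: "rep_ae_fun w \<in> borel_measurable lebesgue" for w by (rule rep_ae_fun_measurable)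
  have [measurable]: "\<psi> \<in> borel_measurable lebesgue"
    using borel_measurable_continuous_onI[OF \<psi>] by (simp add: measurable_completion)
  have "(LINT x:\<Omega>|lebesgue. rep_ae_fun (u + v) x * \<psi> x)
      = (LINT x:\<Omega>|lebesgue. rep_ae_fun u x * \<psi> x + rep_ae_fun v x * \<psi> x)"
  proof (rule set_lebesgue_integral_cong_AE)
    show "AE x\<in>\<Omega> in lebesgue. rep_ae_fun (u + v) x * \<psi> x = rep_ae_fun u x * \<psi> x + rep_ae_fun v x * \<psi> x"
      using rep_ae_fun_plus[of u v] by eventually_elim (simp add: distrib_right)
  qed (use \<Omega>(1) in measurable)
  then show ?thesis
    using uv by (simp add: set_integral_add(2) L2_times_continuous_integrable[OF \<Omega> _ \<psi>])
qed

lemma L2_pairing_scaleR: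
  assumes \<Omega>: "\<Omega> \<in> sets lebesgue" and \<psi>: "continuous_on UNIV \<psi>"
  shows "(LINT x:\<Omega>|lebesgue. rep_ae_fun (c *\<^sub>R u) x * \<psi> x)
    = c * (LINT x:\<Omega>|lebesgue. rep_ae_fun u x * \<psi> x)"
proof -
  have [measurable]: "rep_ae_fun w \<in> borel_measurable lebesgue" for w by (rule rep_ae_fun_measurable)
  have [measurable]: "\<psi> \<in> borel_measurable lebesgue"
    using borel_measurable_continuous_onI[OF \<psi>] by (simp add: measurable_completion)
  have "(LINT x:\<Omega>|lebesgue. rep_ae_fun (c *\<^sub>R u) x * \<psi> x)
      = (LINT x:\<Omega>|lebesgue. c * (rep_ae_fun u x * \<psi> x))"
  proof (rule set_lebesgue_integral_cong_AE)
    show "AE x\<in>\<Omega> in lebesgue. rep_ae_fun (c *\<^sub>R u) x * \<psi> x = c * (rep_ae_fun u x * \<psi> x)"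
      using rep_ae_fun_scaleR[of c u] by eventually_elim simp
  qed (use \<Omega> in measurable)
  then show ?thesis by simp
qed

section \<open>Linearity and uniqueness of weak derivatives\<close>

lemma test_function_continuous:
  assumes "\<phi> \<in> test_functions \<Omega>"
  shows "continuous_on UNIV \<phi>"
    and "b \<in> Basis \<Longrightarrow> continuous_on UNIV (\<lambda>x. frechet_derivative \<phi> (at x) b)"
proof -
  have "Ck_on 0 UNIV \<phi>" "Ck_on (Suc 0) UNIV \<phi>" using assms by (auto simp: test_functions_def)
  then show "continuous_on UNIV \<phi>"
    and "b \<in> Basis \<Longrightarrow> continuous_on UNIV (\<lambda>x. frechet_derivative \<phi> (at x) b)" by auto
qed

lemma has_weak_deriv_add:
  assumes \<Omega>: "\<Omega> \<in> sets lebesgue" "bounded \<Omega>" and "b \<in> Basis"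
    and L2: "u \<in> L2 \<Omega>" "v \<in> L2 \<Omega>" "w \<in> L2 \<Omega>" "z \<in> L2 \<Omega>"
    and "has_weak_deriv \<Omega> b u w" "has_weak_deriv \<Omega> b v z"
  shows "has_weak_deriv \<Omega> b (u + v) (w + z)"
  using assms(3-)
  by (simp add: has_weak_deriv_def test_function_continuous L2_pairing_add[OF \<Omega>])

lemma has_weak_deriv_scaleR:
  assumes "\<Omega> \<in> sets lebesgue" and "b \<in> Basis" and "has_weak_deriv \<Omega> b u w"
  shows "has_weak_deriv \<Omega> b (c *\<^sub>R u) (c *\<^sub>R w)"
  using assms
  by (simp add: has_weak_deriv_def test_function_continuous L2_pairing_scaleR)

lemma has_weak_deriv_unique:
  assumes "open \<Omega>" "bounded \<Omega>" and L2: "w \<in> L2 \<Omega>" "z \<in> L2 \<Omega>"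
    and w: "has_weak_deriv \<Omega> b u w" and z: "has_weak_deriv \<Omega> b u z"
  shows "w = z"
proof -
  have \<Omega>: "\<Omega> \<in> sets lebesgue" "bounded \<Omega>" using assms(1,2) by (auto intro: lmeasurable_open fmeasurableD)
  \<comment> \<open>The difference is written with sum and scaling, the operations for which the
    pairing lemmas are available.\<close>
  let ?g = "w + (-1) *\<^sub>R z"
  have g: "?g \<in> L2 \<Omega>" using L2 subspace_L2 by (blast intro: subspace_add subspace_scale)
  have "AE x in lebesgue. x \<in> \<Omega> \<longrightarrow> rep_ae_fun ?g x = 0"
  proof (rule AE_0_if_test_integrals_0[OF \<open>open \<Omega>\<close>])
    show "set_integrable lebesgue \<Omega> (rep_ae_fun ?g)"
      \<comment> \<open>Pairing with the constant 1: on a bounded set, square integrable functions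
        are integrable.\<close>
      using L2_times_continuous_integrable[OF \<Omega> g, of "\<lambda>_. 1"] by simp
    fix \<phi> assume \<phi>: "\<phi> \<in> test_functions \<Omega>"
    have cont: "continuous_on UNIV \<phi>" using \<phi> by (rule test_function_continuous)
    have "(LINT x:\<Omega>|lebesgue. rep_ae_fun ?g x * \<phi> x)
        = (LINT x:\<Omega>|lebesgue. rep_ae_fun w x * \<phi> x)
          + (LINT x:\<Omega>|lebesgue. rep_ae_fun ((-1) *\<^sub>R z) x * \<phi> x)"
      using L2 by (intro L2_pairing_add[OF \<Omega> _ _ cont] subspace_scale[OF subspace_L2])
    also have "\<dots> = (LINT x:\<Omega>|lebesgue. rep_ae_fun w x * \<phi> x)
          + (-1) * (LINT x:\<Omega>|lebesgue. rep_ae_fun z x * \<phi> x)"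
      by (simp only: L2_pairing_scaleR[OF \<Omega>(1) cont])
    also have "\<dots> = 0"
      using w z \<phi> by (simp add: has_weak_deriv_def)
    finally show "(LINT x:\<Omega>|lebesgue. rep_ae_fun ?g x * \<phi> x) = 0" .
  qed
  then have "AE x in lebesgue. rep_ae_fun ?g x = rep_ae_fun 0 x"
    using L2_AE_outside[OF g] rep_ae_fun_zero by eventually_elim auto
  then have "?g = 0" by (rule ae_fun_eqI)
  then show ?thesis by simp
qed

lemma weak_deriv_eqI:
  assumes "open \<Omega>" "bounded \<Omega>" "w \<in> L2 \<Omega>" "has_weak_deriv \<Omega> b u w"
  shows "weak_deriv \<Omega> b u = w"
  unfolding weak_deriv_def
  by (rule the_equality) (use assms has_weak_deriv_unique in blast)+

lemma weak_deriv_H1: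
  assumes "open \<Omega>" "bounded \<Omega>" "u \<in> H1 \<Omega>" "b \<in> Basis"
  shows "weak_deriv \<Omega> b u \<in> L2 \<Omega>" "has_weak_deriv \<Omega> b u (weak_deriv \<Omega> b u)"
proof -
  obtain w where w: "w \<in> L2 \<Omega>" "has_weak_deriv \<Omega> b u w"
    using assms(3,4) unfolding H1_def by blast
  with weak_deriv_eqI[OF assms(1,2) w]
  show "weak_deriv \<Omega> b u \<in> L2 \<Omega>" "has_weak_deriv \<Omega> b u (weak_deriv \<Omega> b u)" by simp_all
qed

section \<open>The norms of \<open>H1\<close> and of the phase space\<close>

context
  fixes \<Omega> :: "R3 set"
  assumes open_bounded: "open \<Omega>" "bounded \<Omega>"
begin

lemma domain_measurable: "\<Omega> \<in> sets lebesgue"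
  using open_bounded by (auto intro: lmeasurable_open fmeasurableD)

lemma H1_add_weak_deriv:
  assumes "u \<in> H1 \<Omega>" "v \<in> H1 \<Omega>" "b \<in> Basis"
  shows "has_weak_deriv \<Omega> b (u + v) (weak_deriv \<Omega> b u + weak_deriv \<Omega> b v)"
    and "weak_deriv \<Omega> b u + weak_deriv \<Omega> b v \<in> L2 \<Omega>"
  using assms weak_deriv_H1[OF open_bounded] domain_measurable open_bounded(2) subspace_L2
  by (auto intro!: has_weak_deriv_add subspace_add simp: H1_def)

lemma H1_scaleR_weak_deriv:
  assumes "u \<in> H1 \<Omega>" "b \<in> Basis"
  shows "has_weak_deriv \<Omega> b (c *\<^sub>R u) (c *\<^sub>R weak_deriv \<Omega> b u)"
    and "c *\<^sub>R weak_deriv \<Omega> b u \<in> L2 \<Omega>"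
  using assms weak_deriv_H1[OF open_bounded] domain_measurable subspace_L2
  by (auto intro!: has_weak_deriv_scaleR subspace_scale)

lemma weak_deriv_add:
  "u \<in> H1 \<Omega> \<Longrightarrow> v \<in> H1 \<Omega> \<Longrightarrow> b \<in> Basis \<Longrightarrow>
    weak_deriv \<Omega> b (u + v) = weak_deriv \<Omega> b u + weak_deriv \<Omega> b v"
  using H1_add_weak_deriv by (intro weak_deriv_eqI[OF open_bounded])

lemma weak_deriv_scaleR:
  "u \<in> H1 \<Omega> \<Longrightarrow> b \<in> Basis \<Longrightarrow> weak_deriv \<Omega> b (c *\<^sub>R u) = c *\<^sub>R weak_deriv \<Omega> b u"
  using H1_scaleR_weak_deriv by (intro weak_deriv_eqI[OF open_bounded])

lemma subspace_H1: "subspace (H1 \<Omega>)"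
proof (rule subspaceI)
  \<comment> \<open>The representative of 0 is 0 only almost everywhere, so its pairings are
    evaluated by the scaling rule with factor 0.\<close>
  have "has_weak_deriv \<Omega> b 0 0" if "b \<in> Basis" for b
    using that L2_pairing_scaleR[OF domain_measurable, of _ 0 0]
    by (simp add: has_weak_deriv_def test_function_continuous)
  then show "0 \<in> H1 \<Omega>"
    using subspace_0[OF subspace_L2[of \<Omega>]] by (auto simp: H1_def)
next
  fix u v assume "u \<in> H1 \<Omega>" "v \<in> H1 \<Omega>"
  moreover from this have "u + v \<in> L2 \<Omega>"
    using subspace_L2[of \<Omega>] by (auto simp: H1_def subspace_add)
  ultimately show "u + v \<in> H1 \<Omega>"
    using H1_add_weak_deriv[of u v] by (subst H1_def) blast
next
  fix c u assume "u \<in> H1 \<Omega>"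
  moreover from this have "c *\<^sub>R u \<in> L2 \<Omega>"
    using subspace_L2[of \<Omega>] by (auto simp: H1_def subspace_scale)
  ultimately show "c *\<^sub>R u \<in> H1 \<Omega>"
    using H1_scaleR_weak_deriv[of u _ c] by (subst H1_def) blast
qed

text \<open>Either \<open>bdry_trace\<close> is a chosen trace operator, whose definition contains
  all three properties, or it is the zero map, which has them trivially. The claims are joined so
  that one case distinction settles them.\<close>

lemma bdry_trace_square_integrable:
  "u \<in> H1 \<Omega> \<Longrightarrow> square_integrable (surface_measure \<Omega>) (bdry_trace \<Omega> u)"
  and bdry_trace_add: "u \<in> H1 \<Omega> \<Longrightarrow> v \<in> H1 \<Omega> \<Longrightarrow>
    AE x in surface_measure \<Omega>. bdry_trace \<Omega> (u + v) x = bdry_trace \<Omega> u x + bdry_trace \<Omega> v x"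
  and bdry_trace_scaleR: "u \<in> H1 \<Omega> \<Longrightarrow>
    AE x in surface_measure \<Omega>. bdry_trace \<Omega> (c *\<^sub>R u) x = c * bdry_trace \<Omega> u x"
proof (atomize (full), cases "\<exists>T. trace_operator \<Omega> T")
  case True
  then have "trace_operator \<Omega> (bdry_trace \<Omega>)"
    unfolding bdry_trace_def by (simp add: someI_ex)
  then show "(u \<in> H1 \<Omega> \<longrightarrow> square_integrable (surface_measure \<Omega>) (bdry_trace \<Omega> u)) \<and>
    (u \<in> H1 \<Omega> \<longrightarrow> v \<in> H1 \<Omega> \<longrightarrow>
      (AE x in surface_measure \<Omega>. bdry_trace \<Omega> (u + v) x = bdry_trace \<Omega> u x + bdry_trace \<Omega> v x)) \<and>
    (u \<in> H1 \<Omega> \<longrightarrow> (AE x in surface_measure \<Omega>. bdry_trace \<Omega> (c *\<^sub>R u) x = c * bdry_trace \<Omega> u x))"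
    unfolding trace_operator_def square_integrable_def by blast
next
  case False
  then show "(u \<in> H1 \<Omega> \<longrightarrow> square_integrable (surface_measure \<Omega>) (bdry_trace \<Omega> u)) \<and>
    (u \<in> H1 \<Omega> \<longrightarrow> v \<in> H1 \<Omega> \<longrightarrow>
      (AE x in surface_measure \<Omega>. bdry_trace \<Omega> (u + v) x = bdry_trace \<Omega> u x + bdry_trace \<Omega> v x)) \<and>
    (u \<in> H1 \<Omega> \<longrightarrow> (AE x in surface_measure \<Omega>. bdry_trace \<Omega> (c *\<^sub>R u) x = c * bdry_trace \<Omega> u x))"
    by (simp add: bdry_trace_def square_integrable_def)
qed

text \<open>\<open>seminormed_subspace_comp\<close> would require exact linearity. Traces are
  representatives and linear only almost everywhere, so linearity is used under the
  integral.\<close>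

lemma seminormed_subspace_trace:
  "seminormed_subspace (H1 \<Omega>) (\<lambda>u. sqrt (LINT x|surface_measure \<Omega>. (bdry_trace \<Omega> u x)\<^sup>2))"
proof
  fix u v assume uv: "u \<in> H1 \<Omega>" "v \<in> H1 \<Omega>"
  have "u + v \<in> H1 \<Omega>" using uv subspace_H1 by (simp add: subspace_add)
  then have [measurable]: "bdry_trace \<Omega> u \<in> borel_measurable (surface_measure \<Omega>)"
    "bdry_trace \<Omega> v \<in> borel_measurable (surface_measure \<Omega>)"
    "bdry_trace \<Omega> (u + v) \<in> borel_measurable (surface_measure \<Omega>)"
    using uv bdry_trace_square_integrable by (auto simp: square_integrable_def)
  have "(LINT x|surface_measure \<Omega>. (bdry_trace \<Omega> (u + v) x)\<^sup>2)
      = (LINT x|surface_measure \<Omega>. (bdry_trace \<Omega> u x + bdry_trace \<Omega> v x)\<^sup>2)"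
    by (rule integral_cong_AE, measurable)
      (use bdry_trace_add[OF uv] in \<open>auto elim: eventually_mono\<close>)
  then show "sqrt (LINT x|surface_measure \<Omega>. (bdry_trace \<Omega> (u + v) x)\<^sup>2)
      \<le> sqrt (LINT x|surface_measure \<Omega>. (bdry_trace \<Omega> u x)\<^sup>2)
        + sqrt (LINT x|surface_measure \<Omega>. (bdry_trace \<Omega> v x)\<^sup>2)"
    using Minkowski_integral[OF uv[THEN bdry_trace_square_integrable]] by simp
next
  fix c u assume u: "u \<in> H1 \<Omega>"
  have "c *\<^sub>R u \<in> H1 \<Omega>" using u subspace_H1 by (simp add: subspace_scale)
  then have [measurable]: "bdry_trace \<Omega> u \<in> borel_measurable (surface_measure \<Omega>)"
    "bdry_trace \<Omega> (c *\<^sub>R u) \<in> borel_measurable (surface_measure \<Omega>)"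
    using u bdry_trace_square_integrable by (auto simp: square_integrable_def)
  have "(LINT x|surface_measure \<Omega>. (bdry_trace \<Omega> (c *\<^sub>R u) x)\<^sup>2)
      = (LINT x|surface_measure \<Omega>. c\<^sup>2 * (bdry_trace \<Omega> u x)\<^sup>2)"
    by (rule integral_cong_AE, measurable)
      (use bdry_trace_scaleR[OF u, of c] in \<open>auto simp: power_mult_distrib elim: eventually_mono\<close>)
  then show "sqrt (LINT x|surface_measure \<Omega>. (bdry_trace \<Omega> (c *\<^sub>R u) x)\<^sup>2)
      = \<bar>c\<bar> * sqrt (LINT x|surface_measure \<Omega>. (bdry_trace \<Omega> u x)\<^sup>2)"
    by (simp add: real_sqrt_mult)
qed (rule subspace_H1)

lemma seminormed_subspace_H1: "seminormed_subspace (H1 \<Omega>) (H1_norm \<Omega>)"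
proof -
  let ?G = "\<lambda>u. L2_set (\<lambda>b. L2_norm \<Omega> (weak_deriv \<Omega> b u)) Basis"
  let ?T = "\<lambda>u. sqrt (LINT x|surface_measure \<Omega>. (bdry_trace \<Omega> u x)\<^sup>2)"
  have "seminormed_subspace (H1 \<Omega>) (\<lambda>u. L2_norm \<Omega> (weak_deriv \<Omega> b u))" if "b \<in> Basis" for b
    using that weak_deriv_H1(1)[OF open_bounded] weak_deriv_add weak_deriv_scaleR
    by (intro seminormed_subspace_comp[OF seminormed_subspace_L2[OF domain_measurable] subspace_H1])
  then have "seminormed_subspace (H1 \<Omega>) ?G"
    by (rule seminormed_subspace_L2_set[OF subspace_H1])
  then have "seminormed_subspace (H1 \<Omega>) (\<lambda>u. sqrt ((?G u)\<^sup>2 + (?T u)\<^sup>2))"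
    using seminormed_subspace_trace by (rule seminormed_subspace_sqrt_sum_squares)
  moreover have "H1_norm \<Omega> = (\<lambda>u. sqrt ((?G u)\<^sup>2 + (?T u)\<^sup>2))"
    by (simp add: H1_norm_def fun_eq_iff grad_norm_sq_def L2_set_def sum_nonneg)
  ultimately show ?thesis by simp
qed

lemma seminormed_subspace_H:
  assumes "0 \<le> \<epsilon>"
  shows "seminormed_subspace (H_space \<Omega>) (H_norm \<Omega> \<epsilon>)"
proof -
  have V: "subspace (H_space \<Omega>)"
    unfolding H_space_def using subspace_H1 subspace_L2 by (rule subspace_Times)
  have "seminormed_subspace (H_space \<Omega>) (\<lambda>x. H1_norm \<Omega> (fst x))"
    by (rule seminormed_subspace_comp[OF seminormed_subspace_H1 V]) (auto simp: H_space_def)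
  \<comment> \<open>The weight \<open>\<epsilon>\<close> of the squared norm is the factor
    \<open>sqrt \<epsilon>\<close> of a seminorm.\<close>
  moreover have "seminormed_subspace (H_space \<Omega>) (\<lambda>x. sqrt \<epsilon> * L2_norm \<Omega> (snd x))"
    by (intro seminormed_subspace_scale real_sqrt_ge_zero assms
        seminormed_subspace_comp[OF seminormed_subspace_L2[OF domain_measurable] V])
      (auto simp: H_space_def)
  ultimately have "seminormed_subspace (H_space \<Omega>)
      (\<lambda>x. sqrt ((H1_norm \<Omega> (fst x))\<^sup>2 + (sqrt \<epsilon> * L2_norm \<Omega> (snd x))\<^sup>2))"
    by (rule seminormed_subspace_sqrt_sum_squares)
  moreover have "H_norm \<Omega> \<epsilon> = (\<lambda>x. sqrt ((H1_norm \<Omega> (fst x))\<^sup>2 + (sqrt \<epsilon> * L2_norm \<Omega> (snd x))\<^sup>2))"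
    using assms by (simp add: H_norm_def fun_eq_iff power_mult_distrib)
  ultimately show ?thesis by simp
qed

end

theorem corollary4p3:
  fixes \<Omega> :: "(real^3) set" and f :: "real \<Rightarrow> real" and \<epsilon> :: real
    and \<A> \<M> :: "(ae_fun \<times> ae_fun) set"
  assumes "C2_bounded_domain \<Omega>"
    and "Ck_on 2 UNIV f" and "F1 f" and "F2 \<Omega> f" and "F3 f"
    and "0 < \<epsilon>" and "\<epsilon> \<le> 1"
    and "global_attractor (H_space \<Omega>) (H_norm \<Omega> \<epsilon>) (S_op \<Omega> \<epsilon> f) \<A>"
    and "exponential_attractor (H_space \<Omega>) (H_norm \<Omega> \<epsilon>) (S_op \<Omega> \<epsilon> f) \<M>"
  shows "fractal_dim (H_space \<Omega>) (H_norm \<Omega> \<epsilon>) \<A> \<le> fractal_dim (H_space \<Omega>) (H_norm \<Omega> \<epsilon>) \<M> \<and>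
      fractal_dim (H_space \<Omega>) (H_norm \<Omega> \<epsilon>) \<A> < \<infinity>"
proof -
  have "open \<Omega>" "bounded \<Omega>" using assms(1) by (simp_all add: C2_bounded_domain_def)
  then interpret seminormed_subspace "H_space \<Omega>" "H_norm \<Omega> \<epsilon>"
    using \<open>0 < \<epsilon>\<close> by (intro seminormed_subspace_H) auto
  have le: "fractal_dim (H_space \<Omega>) (H_norm \<Omega> \<epsilon>) \<A> \<le> fractal_dim (H_space \<Omega>) (H_norm \<Omega> \<epsilon>) \<M>"
    using assms(8,9) by (rule fractal_dim_global_attractor_le)
  also have "fractal_dim (H_space \<Omega>) (H_norm \<Omega> \<epsilon>) \<M> < \<infinity>"
    using assms(9) by (simp add: exponential_attractor_def)
  finally show ?thesis using le by simp
qed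

end
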